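(* Let $n\geq1$ and $1\leq p<q<\infty$. Then $$\tilde{\mathsf{A}}^\star_{p,q}(\gamma_n)=2^{1/p-1/q}\,\frac{\|Z\|_{L^q}}{\|Z\|_{L^p}},$$ where $Z\sim N(0,1)$. Consequently, $$\tilde{\mathsf{A}}^\star_{p,q}(\sigma_{n-1})=2^{1/p-1/q}\,\frac{\|Z\|_{L^q}/\|Z\|_{L^p}}{\|\chi_n\|_{L^q}/\|\chi_n\|_{L^p}}.$$ Moreover, both suprema (defining $\tilde{\mathsf{A}}^\star_{p,q}(\gamma_n)$ and $\tilde{\mathsf{A}}^\star_{p,q}(\sigma_{n-1})$) are attained by the ray $K_n^\star=\{\lambda e_1:\lambda\geq0\}$.
   Context: $\mathcal{K}_n$ is the class of closed convex cones in $\mathbb{R}^n$; $\Pi_K(x)=\arg\min_{y\in K}\|x-y\|_2$ is the metric projection. $\gamma_n$ is the standard Gaussian measure on $\mathbb{R}^n$ and $\sigma_{n-1}$ is the uniform probability measure on the unit sphere $\mathbf{S}^{n-1}$ (for $n=1$, uniform on $\{-1,1\}$). $\|\Pi_K\|_{L^p(\mu)}=(\mathbf{E}_{\xi\sim\mu}\|\Pi_K(\xi)\|_2^p)^{1/p}$, and for a real random variable $X$, $\|X\|_{L^p}=(\mathbf{E}|X|^p)^{1/p}$. $\chi_n$ denotes a random variable distributed as $\|G\|_2$ with $G\sim\gamma_n$. $e_1$ is the first standard basis vector. For a probability measure $\mu$, $$\tilde{\mathsf{A}}^\star_{p,q}(\mu)=\sup_{K\in\mathcal{K}_n,\,K\neq\{0\}}\frac{\|\Pi_K\|_{L^q(\mu)}}{\|\Pi_K\|_{L^p(\mu)}}.$$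 *)

theory Defs
  imports "HOL-Probability.Probability"
begin

definition closed_convex_cones :: "'a::euclidean_space set set" where
  "closed_convex_cones = {K. closed K \<and> convex K \<and> cone K \<and> K \<noteq> {}}"

definition Lp_norm :: "'a measure \<Rightarrow> real \<Rightarrow> ('a \<Rightarrow> 'b::real_normed_vector) \<Rightarrow> real" where
  "Lp_norm M p f = (LINT x|M. norm (f x) powr p) powr (1 / p)"

definition std_gaussian :: "(real ^ 'n) measure" where
  "std_gaussian = density lborel (\<lambda>x. ennreal (\<Prod>i\<in>UNIV. std_normal_density (x $ i)))"

(* The uniform probability measure on the unit sphere, realised as a Borel measure on the whole
   space: the law of the direction of a uniform point of the unit ball (the normalised surface
   measure, also known as the cone measure). The null point 0 is sent to 0. *)
definition uniform_sphere :: "'a::euclidean_space measure" where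
  "uniform_sphere = distr (uniform_measure lborel (ball 0 1)) borel (\<lambda>x. x /\<^sub>R norm x)"

(* closest_point K is the metric projection onto K. *)
definition proj_ratio :: "real \<Rightarrow> real \<Rightarrow> 'a::euclidean_space measure \<Rightarrow> 'a set \<Rightarrow> real" where
  "proj_ratio p q \<mu> K = Lp_norm \<mu> q (closest_point K) / Lp_norm \<mu> p (closest_point K)"

(* The supremum is taken in the extended reals, so that an unbounded family of ratios would give
   \<infinity> and not an unspecified real. *)
definition A_star :: "real \<Rightarrow> real \<Rightarrow> 'a::euclidean_space measure \<Rightarrow> ereal" where
  "A_star p q \<mu> = (SUP K \<in> closed_convex_cones - {{0}}. ereal (proj_ratio p q \<mu> K))"

definition ray :: "'a::real_vector \<Rightarrow> 'a set" where
  "ray e = {c *\<^sub>R e | c. c \<ge> 0}"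

lemma prob_space_uniform_ball:
  "prob_space (uniform_measure lborel (ball (0::'a::euclidean_space) 1))"
proof (rule prob_space_uniform_measure)
  have "measure lborel (ball (0::'a) 1) > 0"
    by (simp add: content_ball_pos)
  then show "emeasure lborel (ball (0::'a) 1) \<noteq> 0"
    by (simp add: measure_def zero_less_measure_iff)
       (metis enn2real_0 less_irrefl)
  show "emeasure lborel (ball (0::'a) 1) \<noteq> \<infinity>"
    using emeasure_lborel_ball_finite[of "0::'a" 1] by simp
qed

lemma prob_space_uniform_sphere: "prob_space (uniform_sphere :: 'a::euclidean_space measure)"
  unfolding uniform_sphere_def
  by (rule prob_space.prob_space_distr[OF prob_space_uniform_ball]) simp

lemma AE_uniform_sphere: "AE x in (uniform_sphere :: 'a::euclidean_space measure). x \<in> sphere 0 1"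
proof -
  have "AE x in (lborel :: 'a measure). x \<noteq> 0"
    by (rule AE_lborel_singleton)
  then have "AE x in uniform_measure lborel (ball (0::'a) 1). x \<noteq> 0"
    by (intro AE_uniform_measureI) auto
  then have "AE x in uniform_measure lborel (ball (0::'a) 1). x /\<^sub>R norm x \<in> sphere 0 1"
    by eventually_elim simp
  then show ?thesis
    unfolding uniform_sphere_def by (subst AE_distr_iff) auto
qed

(* The wellorder sort comes from measure_orthogonal_image. *)
lemma distr_uniform_sphere_orthogonal:
  fixes f :: "real ^ 'n::{finite,wellorder} \<Rightarrow> real ^ 'n::{finite,wellorder}"
  assumes f: "orthogonal_transformation f"
  shows "distr uniform_sphere borel f = uniform_sphere"
proof -
  have fm [measurable]: "f \<in> borel_measurable borel"
    by (intro borel_measurable_continuous_onI linear_continuous_on)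
       (simp add: f linear_linear orthogonal_transformation_linear)
  have lin: "linear f"
    by (simp add: f orthogonal_transformation_linear)
  define g where "g = inv f"
  have g: "orthogonal_transformation g"
    by (simp add: g_def f orthogonal_transformation_inv)
  have gf: "g (f x) = x" for x
    by (simp add: g_def f orthogonal_transformation_inj)
  have fg: "f (g x) = x" for x
    by (simp add: g_def f orthogonal_transformation_surj surj_f_inv_f)
  have nf: "norm (f x) = norm x" for x
    by (simp add: f orthogonal_transformation_norm)
  let ?B = "ball (0 :: real ^ 'n::{finite,wellorder}) 1"
  let ?U = "uniform_measure lborel ?B"
  have inv: "distr ?U borel f = ?U"
  proof (rule measure_eqI)
    fix A :: "(real ^ 'n::{finite,wellorder}) set"
    assume "A \<in> sets (distr ?U borel f)"
    then have A [measurable]: "A \<in> sets borel"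
      by simp
    have fA [measurable]: "f -` A \<in> sets borel"
      using measurable_sets[OF fm A] by simp
    have eq: "?B \<inter> f -` A = g ` (?B \<inter> A)"
    proof (intro equalityI subsetI)
      fix x assume "x \<in> ?B \<inter> f -` A"
      then show "x \<in> g ` (?B \<inter> A)"
        by (intro image_eqI[of _ _ "f x"]) (auto simp: gf nf)
    next
      fix x assume "x \<in> g ` (?B \<inter> A)"
      then show "x \<in> ?B \<inter> f -` A"
        using g by (auto simp: fg orthogonal_transformation_norm)
    qed
    have fin: "emeasure lborel (?B \<inter> C) < \<infinity>" if "C \<in> sets borel" for C
    proof -
      have "emeasure lborel (?B \<inter> C) \<le> emeasure lborel ?B"
        using that by (intro emeasure_mono) auto
      then show ?thesis
        using emeasure_bounded_finite[of ?B] by auto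
    qed
    have lm: "?B \<inter> A \<in> lmeasurable"
      by (simp add: bounded_set_imp_lmeasurable sets_completionI_sets bounded_Int)
    have "emeasure lborel (?B \<inter> f -` A) = emeasure lborel (?B \<inter> A)"
    proof -
      have "measure lborel (?B \<inter> f -` A) = measure lebesgue (g ` (?B \<inter> A))"
        unfolding eq[symmetric] by (simp add: measure_completion)
      also have "\<dots> = measure lebesgue (?B \<inter> A)"
        by (rule measure_orthogonal_image[OF g lm])
      also have "\<dots> = measure lborel (?B \<inter> A)"
        by (simp add: measure_completion)
      finally show ?thesis
        using fin[OF A] fin[OF fA] by (simp add: emeasure_eq_ennreal_measure)
    qed
    then show "emeasure (distr ?U borel f) A = emeasure ?U A"
      by (simp add: emeasure_distr)
  qed simp
  have "distr uniform_sphere borel f = distr ?U borel (\<lambda>x. f (x /\<^sub>R norm x))"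
    unfolding uniform_sphere_def by (subst distr_distr) (auto simp: o_def)
  also have "\<dots> = distr ?U borel ((\<lambda>x. x /\<^sub>R norm x) \<circ> f)"
    by (simp add: o_def nf linear_scale[OF lin])
  also have "\<dots> = distr (distr ?U borel f) borel (\<lambda>x. x /\<^sub>R norm x)"
    by (subst distr_distr) auto
  also have "\<dots> = uniform_sphere"
    by (simp only: inv uniform_sphere_def)
  finally show ?thesis .
qed

end

(* Let R x be the norm of the projection of x onto K, F its distribution function under the Gaussian
   measure and Phi the standard normal one. R is 1-Lipschitz, so the Gaussian isoperimetric inequality
   says that quantile o F grows at least at unit speed; and F <= Phi, because K contains a ray. Scale
   the projection onto a ray by the factor l >= 1 that equates the p-th moments: its distribution
   function is Phi (t / l) for t >= 0, and F crosses it exactly once, from below, so the q-th moment of R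
   is the smaller one. The isoperimetric inequality is obtained from Bobkov's functional inequality,
   i.e. the two-point inequality, induction along a random walk, the central limit theorem and
   tensorisation, applied to Phi ((t - R) / s) with R regularised, and s -> 0. On the sphere the
   maximiser is the same, because the norm and the direction of a Gaussian vector are independent. *)
theory Submission
  imports Defs
begin

section \<open>The Gaussian profile and the two-point inequality\<close>

text \<open>The functional form of isoperimetry is used because it passes to products: a further
  coordinate adds one squared partial derivative under the root, and the norm inequality for
  vector-valued integrals absorbs it. The cut-off is \<open>Phi ((t - R) / s)\<close> because
  \<open>profile (Phi a)\<close> is the normal density at \<open>a\<close>, while the gradient has
  length at most that density divided by \<open>s\<close>. Both terms under the root are then
  controlled by the \<open>t\<close>-derivative of the mean \<open>A t\<close> of the cut-off, and
  Bobkov's inequality turns into a differential inequality: \<open>quantile o A\<close> has slope at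
  least \<open>1 / sqrt (1 + s\<^sup>2)\<close>. The projection norm may have a kink where it
  vanishes and its law may have an atom at 0, so the differential inequality is proved for the
  regularised norm and only its integrated form goes to the limit. The crossing is one-sided because
  the quantile of \<open>Phi (t / l)\<close> has slope \<open>1 / l\<close>, at most 1: once
  \<open>F\<close> is above, it stays above. The factor \<open>2 powr (1 / p - 1 / q)\<close>
  reflects that a ray sees half of each absolute moment of a normal variable.\<close>

definition Phi :: "real \<Rightarrow> real" where
  "Phi = cdf std_normal_distribution"

text \<open>Only meaningful on the open unit interval: \<open>inv\<close> returns an arbitrary value
  off the range of \<open>Phi\<close>.\<close>

definition quantile :: "real \<Rightarrow> real" where
  "quantile = inv Phi"

text \<open>The Gaussian isoperimetric profile: the Gaussian boundary measure of a half-space of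
  measure \<open>s\<close>.\<close>

definition profile :: "real \<Rightarrow> real" where
  "profile s = std_normal_density (quantile s)"

interpretation std_normal: real_distribution std_normal_distribution
  by (rule real_dist_normal_dist)

lemma std_normal_density_le_1: "std_normal_density x \<le> 1"
proof -
  have "sqrt (2 * pi) \<ge> sqrt 1"
    using pi_gt3 by (intro real_sqrt_le_mono) auto
  then have "1 / sqrt (2 * pi) \<le> 1" by (simp add: field_simps)
  moreover have "exp (- x\<^sup>2 / 2) \<le> 1" by simp
  ultimately show ?thesis
    unfolding std_normal_density_def by (intro mult_le_one) auto
qed

lemma has_real_derivative_std_normal_density:
  "(std_normal_density has_real_derivative - x * std_normal_density x) (at x)"
  unfolding std_normal_density_def[abs_def]
  by (auto intro!: derivative_eq_intros simp: field_simps power2_eq_square)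

lemma continuous_on_std_normal_density: "continuous_on A std_normal_density"
  by (meson DERIV_isCont continuous_at_imp_continuous_on has_real_derivative_std_normal_density)

lemma std_normal_density_uminus: "std_normal_density (- x) = std_normal_density x"
  by (simp add: std_normal_density_def)

lemma std_normal_density_antimono:
  "\<bar>x\<bar> \<le> \<bar>y\<bar> \<Longrightarrow> std_normal_density y \<le> std_normal_density x"
  unfolding std_normal_density_def
  by (auto simp: abs_le_square_iff intro!: divide_right_mono)

lemma Phi_diff:
  assumes "a \<le> b"
  shows "Phi b - Phi a = integral {a..b} std_normal_density"
proof (cases "a < b")
  case True
  have si: "set_integrable lborel {a..b} std_normal_density"
    by (rule borel_integrable_atLeastAtMost') (rule continuous_on_std_normal_density)
  have "Phi b - Phi a = measure std_normal_distribution {a<..b}"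
    unfolding Phi_def using True by (rule std_normal.cdf_diff_eq)
  also have "\<dots> = (LINT x|std_normal_distribution. indicator {a<..b} x)"
    by simp
  also have "\<dots> = (LINT x|lborel. indicator {a<..b} x * std_normal_density x)"
    by (subst integral_density) (auto simp: mult.commute)
  also have "\<dots> = (LINT x:{a..b}|lborel. std_normal_density x)"
    unfolding set_lebesgue_integral_def
    using AE_lborel_singleton[of a]
    by (intro integral_cong_AE) (auto elim!: eventually_mono simp: indicator_def)
  also have "\<dots> = integral {a..b} std_normal_density"
    using si by (rule set_borel_integral_eq_integral)
  finally show ?thesis .
qed (use assms in auto)


lemma has_real_derivative_Phi: "(Phi has_real_derivative std_normal_density x) (at x)"
proof -
  have "((\<lambda>u. integral {x - 1..u} std_normal_density) has_real_derivative std_normal_density x)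
          (at x within {x - 1..x + 1})"
    by (rule integral_has_real_derivative[OF continuous_on_std_normal_density]) simp
  then have "((\<lambda>u. integral {x - 1..u} std_normal_density) has_real_derivative std_normal_density x) (at x)"
    using at_within_Icc_at[of "x - 1" x "x + 1"] by simp
  then have "((\<lambda>u. Phi (x - 1) + integral {x - 1..u} std_normal_density)
      has_real_derivative std_normal_density x) (at x)"
    using DERIV_add[OF DERIV_const] by fastforce
  then show ?thesis
  proof (rule has_field_derivative_transform_within_open)
    show "Phi (x - 1) + integral {x - 1..u} std_normal_density = Phi u" if "u \<in> {x - 1<..<x + 1}" for u
      using that Phi_diff[of "x - 1" u] by auto
  qed auto
qed

lemma isCont_Phi: "isCont Phi x"
  by (rule DERIV_isCont) (rule has_real_derivative_Phi)

lemma strict_mono_Phi: "strict_mono Phi"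
proof (rule strict_monoI)
  fix x y :: real assume "x < y"
  then show "Phi x < Phi y"
    by (rule DERIV_pos_imp_increasing) (meson has_real_derivative_Phi normal_density_pos zero_less_one)
qed

lemma Phi_less_iff [simp]: "Phi x < Phi y \<longleftrightarrow> x < y"
  and Phi_le_iff [simp]: "Phi x \<le> Phi y \<longleftrightarrow> x \<le> y"
  using strict_mono_Phi by (auto simp: strict_mono_less strict_mono_less_eq)

lemma Phi_at_top: "(Phi \<longlongrightarrow> 1) at_top"
  unfolding Phi_def by (rule std_normal.cdf_lim_at_top_prob)

lemma Phi_at_bot: "(Phi \<longlongrightarrow> 0) at_bot"
  unfolding Phi_def by (rule std_normal.cdf_lim_at_bot)

lemma Phi_bounds: "0 < Phi x" "Phi x < 1"
proof -
  have "Phi (x - 1) < Phi x" "Phi x < Phi (x + 1)" by simp_all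
  moreover have "0 \<le> Phi (x - 1)" "Phi (x + 1) \<le> 1"
    unfolding Phi_def by (rule std_normal.cdf_nonneg, rule std_normal.cdf_bounded_prob)
  ultimately show "0 < Phi x" "Phi x < 1" by linarith+
qed

lemma Phi_surj:
  assumes "0 < s" "s < 1"
  obtains x where "Phi x = s"
proof -
  have "eventually (\<lambda>x. Phi x < s) at_bot" "eventually (\<lambda>x. Phi x > s) at_top"
    using order_tendstoD(2)[OF Phi_at_bot assms(1)] order_tendstoD(1)[OF Phi_at_top assms(2)] by auto
  then obtain a b where "Phi a < s" "s < Phi b"
    by (metis eventually_at_bot_linorder eventually_at_top_linorder order_refl)
  then have "\<exists>x\<ge>a. x \<le> b \<and> Phi x = s"
    by (intro IVT) (auto intro: isCont_Phi, smt (verit) Phi_less_iff)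
  then show ?thesis using that by blast
qed

lemma quantile_Phi [simp]: "quantile (Phi x) = x"
  unfolding quantile_def using strict_mono_Phi by (simp add: inv_f_f strict_mono_imp_inj_on)

lemma Phi_quantile: "0 < s \<Longrightarrow> s < 1 \<Longrightarrow> Phi (quantile s) = s"
  by (metis Phi_surj quantile_Phi)

lemma quantile_mono: "0 < s \<Longrightarrow> s \<le> t \<Longrightarrow> t < 1 \<Longrightarrow> quantile s \<le> quantile t"
  by (metis Phi_le_iff Phi_quantile dual_order.strict_trans1 order_le_less_trans)

lemma isCont_quantile: "0 < s \<Longrightarrow> s < 1 \<Longrightarrow> isCont quantile s"
  using isCont_inverse_function[of 1 "quantile s" quantile Phi]
  by (simp add: isCont_Phi Phi_quantile)

lemma has_real_derivative_quantile:
  assumes "0 < s" "s < 1"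
  shows "(quantile has_real_derivative 1 / profile s) (at s)"
proof -
  have "(quantile has_real_derivative inverse (std_normal_density (quantile s))) (at s)"
    by (rule DERIV_inverse_function[where f = Phi and a = 0 and b = 1])
       (auto simp: assms Phi_quantile has_real_derivative_Phi isCont_quantile
         normal_density_pos[THEN less_imp_neq, THEN not_sym])
  then show ?thesis by (simp add: profile_def divide_inverse)
qed

text \<open>True for every real \<open>s\<close>, even where \<open>quantile s\<close> is arbitrary,
  since the density is positive everywhere.\<close>

lemma profile_pos: "0 < profile s"
  unfolding profile_def by (simp add: normal_density_pos)

lemma profile_le_1: "profile s \<le> 1"
  unfolding profile_def by (rule std_normal_density_le_1)

lemma profile_Phi: "profile (Phi x) = std_normal_density x"
  by (simp add: profile_def)

text \<open>Together with the derivative \<open>1 / profile\<close> of \<open>quantile\<close> this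
  is the differential equation \<open>profile * profile'' = -1\<close>, which underlies the
  second-order estimates of the two-point inequality.\<close>

lemma has_real_derivative_profile:
  assumes "0 < s" "s < 1"
  shows "(profile has_real_derivative - quantile s) (at s)"
proof -
  have "((\<lambda>s. std_normal_density (quantile s)) has_real_derivative
          (- quantile s * std_normal_density (quantile s)) * (1 / profile s)) (at s)"
    using assms by (intro DERIV_chain2[OF has_real_derivative_std_normal_density]
        has_real_derivative_quantile)
  then show ?thesis
    using profile_pos[of s] by (simp add: profile_def[abs_def])
qed

lemma continuous_on_profile: "continuous_on {0<..<1} profile"
  by (auto intro!: continuous_at_imp_continuous_on DERIV_isCont[OF has_real_derivative_profile])

text \<open>The sum \<open>Phi (- x) + Phi x\<close> has derivative 0 because the density is even;
  its constant value is read off at infinity.\<close>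

lemma Phi_uminus: "Phi (- x) = 1 - Phi x"
proof -
  have "((\<lambda>x. Phi (- x) + Phi x) has_real_derivative 0) (at y)" for y
    using DERIV_add[OF DERIV_chain2[OF has_real_derivative_Phi DERIV_minus[OF DERIV_ident]] has_real_derivative_Phi]
    by (simp add: std_normal_density_uminus)
  then have const: "Phi (- a) + Phi a = Phi (- b) + Phi b" for a b
    using DERIV_isconst_all[of "\<lambda>x. Phi (- x) + Phi x"] by blast
  have "((\<lambda>a. Phi (- a) + Phi a) \<longlongrightarrow> 0 + 1) at_top"
    by (intro tendsto_add Phi_at_top filterlim_compose[OF Phi_at_bot] filterlim_uminus_at_bot_at_top)
  moreover have "((\<lambda>a. Phi (- a) + Phi a) \<longlongrightarrow> Phi (- x) + Phi x) at_top"
    by (subst const[of _ x]) (rule tendsto_const)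
  ultimately have "Phi (- x) + Phi x = 0 + 1"
    using tendsto_unique by (metis trivial_limit_at_top_linorder)
  then show ?thesis by simp
qed

lemma quantile_one_minus: "0 < s \<Longrightarrow> s < 1 \<Longrightarrow> quantile (1 - s) = - quantile s"
  by (metis Phi_quantile Phi_uminus quantile_Phi)

lemma profile_one_minus: "0 < s \<Longrightarrow> s < 1 \<Longrightarrow> profile (1 - s) = profile s"
  by (simp add: profile_def quantile_one_minus std_normal_density_uminus)

section \<open>Second-order estimates for the squared profile\<close>

lemma convex_on_quantile_sq: "convex_on {0<..<1} (\<lambda>s. (quantile s)\<^sup>2)"
proof (rule f''_ge0_imp_convex)
  show "((\<lambda>s. (quantile s)\<^sup>2) has_real_derivative 2 * quantile s / profile s) (at s)"
    if "s \<in> {0<..<1}" for s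
    using that by (auto intro!: derivative_eq_intros has_real_derivative_quantile)
  show "((\<lambda>s. 2 * quantile s / profile s) has_real_derivative
      2 * (1 + (quantile s)\<^sup>2) / (profile s)\<^sup>2) (at s)" if "s \<in> {0<..<1}" for s
    using that profile_pos[of s]
    by (auto intro!: derivative_eq_intros has_real_derivative_quantile has_real_derivative_profile
        simp: field_simps power2_eq_square)
qed auto

lemma has_real_derivative_profile_sq:
  "0 < s \<Longrightarrow> s < 1 \<Longrightarrow>
    ((\<lambda>s. (profile s)\<^sup>2) has_real_derivative - (2 * profile s * quantile s)) (at s)"
  by (auto intro!: derivative_eq_intros has_real_derivative_profile)

lemma has_real_derivative_profile_quantile:
  "0 < s \<Longrightarrow> s < 1 \<Longrightarrow>
    ((\<lambda>s. profile s * quantile s) has_real_derivative 1 - (quantile s)\<^sup>2) (at s)"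
  using profile_pos[of s]
  by (auto intro!: derivative_eq_intros has_real_derivative_profile has_real_derivative_quantile
      simp: power2_eq_square)

lemma nonneg_of_second_derivative:
  fixes f f' f'' :: "real \<Rightarrow> real"
  assumes "\<And>y. 0 \<le> y \<Longrightarrow> y \<le> x \<Longrightarrow> (f has_real_derivative f' y) (at y)"
    and "\<And>y. 0 \<le> y \<Longrightarrow> y \<le> x \<Longrightarrow> (f' has_real_derivative f'' y) (at y)"
    and "\<And>y. 0 \<le> y \<Longrightarrow> y \<le> x \<Longrightarrow> 0 \<le> f'' y"
    and "f 0 = 0" "f' 0 = 0" "0 \<le> x"
  shows "0 \<le> f x"
proof -
  have "0 \<le> f' y" if "0 \<le> y" "y \<le> x" for y
    using DERIV_nonneg_imp_nondecreasing[of 0 y f'] assms that by fastforce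
  then show ?thesis
    using DERIV_nonneg_imp_nondecreasing[of 0 x f] assms by fastforce
qed

text \<open>This is Bobkov's two-point inequality squared twice; both sides are compared with
  \<open>16 v c (quantile c)\<^sup>2 x\<^sup>2\<close>.\<close>

lemma two_point_aux:
  assumes "0 \<le> x" "0 < c - x" "c \<le> 1 / 2"
  defines "v \<equiv> \<lambda>s. (profile s)\<^sup>2"
  shows "(v (c + x) - v (c - x))\<^sup>2 \<le> 8 * v c * (v (c + x) + v (c - x) - 2 * v c + 2 * x\<^sup>2)"
proof -
  define q g where "q = quantile" and "g = (\<lambda>s. profile s * quantile s)"
  have rng: "0 < c + y" "c + y < 1" "0 < c - y" "c - y < 1" if "0 \<le> y" "y \<le> x" for y
    using that assms(1-3) by auto
  have c: "0 < c" "c < 1" using assms by auto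
  have v': "(v has_real_derivative - (2 * g s)) (at s)" if "0 < s" "s < 1" for s
    using has_real_derivative_profile_sq[OF that] by (simp add: v_def g_def mult.assoc)
  have pq: "(g has_real_derivative 1 - (q s)\<^sup>2) (at s)" if "0 < s" "s < 1" for s
    unfolding q_def g_def using that by (rule has_real_derivative_profile_quantile)
  have v'p: "((\<lambda>y. v (c + y)) has_real_derivative - (2 * g (c + y))) (at y)"
    "((\<lambda>y. v (c - y)) has_real_derivative 2 * g (c - y)) (at y)"
    "((\<lambda>y. g (c + y)) has_real_derivative 1 - (q (c + y))\<^sup>2) (at y)"
    "((\<lambda>y. g (c - y)) has_real_derivative (q (c - y))\<^sup>2 - 1) (at y)"
    if "0 \<le> y" "y \<le> x" for y
    using DERIV_chain2[OF v' DERIV_add[OF DERIV_const DERIV_ident], of c y]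
      DERIV_chain2[OF v' DERIV_diff[OF DERIV_const DERIV_ident], of c y]
      DERIV_chain2[OF pq DERIV_add[OF DERIV_const DERIV_ident], of c y]
      DERIV_chain2[OF pq DERIV_diff[OF DERIV_const DERIV_ident], of c y] rng[OF that]
    by simp_all
  \<comment> \<open>Here \<open>v'' = 2 q\<^sup>2 - 2\<close>. The summand
    \<open>2 * x\<^sup>2\<close> cancels the two constants -2, leaving a symmetric sum of values of
    the convex function \<open>q\<^sup>2\<close>, which is smallest at the centre
    \<open>c\<close>.\<close>
  have lower: "0 \<le> v (c + x) + v (c - x) - 2 * v c + 2 * x\<^sup>2 - 2 * (q c)\<^sup>2 * x\<^sup>2"
  proof (rule nonneg_of_second_derivative[where x = x and f = "\<lambda>x. v (c + x) + v (c - x) - 2 * v c + 2 * x\<^sup>2 - 2 * (q c)\<^sup>2 * x\<^sup>2"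
      and f' = "\<lambda>y. 2 * (g (c - y)) - 2 * (g (c + y)) + 4 * y - 4 * (q c)\<^sup>2 * y"
      and f'' = "\<lambda>y. 2 * (q (c - y))\<^sup>2 + 2 * (q (c + y))\<^sup>2 - 4 * (q c)\<^sup>2"])
    fix y assume y: "0 \<le> y" "y \<le> x"
    show "((\<lambda>x. v (c + x) + v (c - x) - 2 * v c + 2 * x\<^sup>2 - 2 * (q c)\<^sup>2 * x\<^sup>2) has_real_derivative
        2 * (g (c - y)) - 2 * (g (c + y)) + 4 * y - 4 * (q c)\<^sup>2 * y) (at y)"
      using v'p[OF y] by (auto intro!: derivative_eq_intros)
    show "((\<lambda>y. 2 * (g (c - y)) - 2 * (g (c + y)) + 4 * y - 4 * (q c)\<^sup>2 * y)
        has_real_derivative 2 * (q (c - y))\<^sup>2 + 2 * (q (c + y))\<^sup>2 - 4 * (q c)\<^sup>2) (at y)"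
      using v'p[OF y] by (auto intro!: derivative_eq_intros)
    have "(q ((1 - 1/2) *\<^sub>R (c - y) + (1/2) *\<^sub>R (c + y)))\<^sup>2 \<le> (1 - 1/2) * (q (c - y))\<^sup>2 + 1/2 * (q (c + y))\<^sup>2"
      unfolding q_def using rng[OF y] by (intro convex_onD[OF convex_on_quantile_sq]) auto
    then show "0 \<le> 2 * (q (c - y))\<^sup>2 + 2 * (q (c + y))\<^sup>2 - 4 * (q c)\<^sup>2"
      by (simp add: field_simps)
  qed (use assms in \<open>auto simp: g_def\<close>)
  have q_abs: "q (c - y) \<le> q (c + y)" "q (c + y) \<le> - q (c - y)" if "0 \<le> y" "y \<le> x" for y
    using rng[OF that] quantile_mono[of "c - y" "c + y"] quantile_mono[of "c + y" "1 - (c - y)"]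
      quantile_one_minus[of "c - y"] that assms(3) by (auto simp: q_def)
  \<comment> \<open>The slope of the odd part at 0 is \<open>2 v'(c) = - 4 g c\<close>. The odd part
    is concave because \<open>c\<close> is at most 1/2, so that \<open>c - y\<close> is at least as
    far from 1/2 as \<open>c + y\<close> and has the larger squared quantile.\<close>
  have upper: "0 \<le> - (4 * g c) * x - (v (c + x) - v (c - x))"
  proof (rule nonneg_of_second_derivative[where x = x and f = "\<lambda>x. - (4 * g c) * x - (v (c + x) - v (c - x))"
      and f' = "\<lambda>y. - (4 * g c) + 2 * (g (c + y)) + 2 * (g (c - y))"
      and f'' = "\<lambda>y. 2 * (q (c - y))\<^sup>2 - 2 * (q (c + y))\<^sup>2"])
    fix y assume y: "0 \<le> y" "y \<le> x"
    show "((\<lambda>x. - (4 * g c) * x - (v (c + x) - v (c - x))) has_real_derivative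
        - (4 * g c) + 2 * (g (c + y)) + 2 * (g (c - y))) (at y)"
      using v'p[OF y] by (auto intro!: derivative_eq_intros)
    show "((\<lambda>y. - (4 * g c) + 2 * (g (c + y)) + 2 * (g (c - y)))
        has_real_derivative 2 * (q (c - y))\<^sup>2 - 2 * (q (c + y))\<^sup>2) (at y)"
      using v'p[OF y] by (auto intro!: derivative_eq_intros)
    have "\<bar>q (c + y)\<bar> \<le> \<bar>q (c - y)\<bar>" using q_abs[OF y] by linarith
    then show "0 \<le> 2 * (q (c - y))\<^sup>2 - 2 * (q (c + y))\<^sup>2"
      by (simp add: abs_le_square_iff)
  qed (use assms in \<open>auto simp: g_def\<close>)
  have "\<bar>q (c + x)\<bar> \<le> \<bar>q (c - x)\<bar>" using q_abs[of x] assms(1) by linarith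
  then have "v (c - x) \<le> v (c + x)"
    unfolding v_def q_def profile_def by (intro power_mono std_normal_density_antimono) auto
  then have "(v (c + x) - v (c - x))\<^sup>2 \<le> (- (4 * g c) * x)\<^sup>2"
    using upper by (intro power_mono) auto
  also have "\<dots> = 8 * v c * (2 * (q c)\<^sup>2 * x\<^sup>2)"
    by (simp add: v_def g_def q_def power_mult_distrib)
  also have "\<dots> \<le> 8 * v c * (v (c + x) + v (c - x) - 2 * v c + 2 * x\<^sup>2)"
    using lower by (intro mult_left_mono) (auto simp: v_def)
  finally show ?thesis .
qed

text \<open>Squaring the claim once gives \<open>4 * u - (a + b) \<le> 2 * sqrt (a * b)\<close>. If
  the left side is positive, squaring again gives exactly the hypothesis; otherwise the claim is
  immediate.\<close>

lemma two_sqrt_le_sqrt_add_sqrt: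
  fixes a b u :: real
  assumes "0 \<le> a" "0 \<le> b" "(a - b)\<^sup>2 \<le> 8 * u * (a + b - 2 * u)"
  shows "2 * sqrt u \<le> sqrt a + sqrt b"
proof (cases "4 * u \<le> a + b")
  case True
  have "sqrt (4 * u) \<le> sqrt a + sqrt b"
    using True assms by (intro real_le_lsqrt) (auto simp: power2_sum add_increasing2)
  then show ?thesis by (simp add: real_sqrt_mult)
next
  case False
  have "(4 * u - (a + b))\<^sup>2 \<le> 4 * (a * b)"
    using assms(3) by (simp add: power2_eq_square algebra_simps)
  then have "4 * u - (a + b) \<le> sqrt (4 * (a * b))"
    by (rule real_le_rsqrt)
  then have "4 * u \<le> (sqrt a + sqrt b)\<^sup>2"
    using assms by (simp add: power2_sum real_sqrt_mult)
  then have "sqrt (4 * u) \<le> sqrt a + sqrt b"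
    using assms by (intro real_le_lsqrt) auto
  then show ?thesis by (simp add: real_sqrt_mult)
qed

lemma two_point_inequality:
  assumes "0 < a" "a < 1" "0 < b" "b < 1"
  shows "profile ((a + b) / 2) \<le>
    (sqrt ((profile a)\<^sup>2 + ((a - b) / 2)\<^sup>2) + sqrt ((profile b)\<^sup>2 + ((a - b) / 2)\<^sup>2)) / 2"
proof -
  have main: "profile ((a + b) / 2) \<le>
    (sqrt ((profile a)\<^sup>2 + ((a - b) / 2)\<^sup>2) + sqrt ((profile b)\<^sup>2 + ((a - b) / 2)\<^sup>2)) / 2"
    if "0 < a" "a \<le> b" "a + b \<le> 1" for a b
  proof -
    define c x where "c = (a + b) / 2" and "x = (b - a) / 2"
    have ab: "c - x = a" "c + x = b" by (auto simp: c_def x_def field_simps)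
    \<comment> \<open>The twice squared inequality, with \<open>u = (profile c)\<^sup>2\<close>;
      adding \<open>x\<^sup>2\<close> to both squared profiles leaves their difference unchanged and
      produces the term \<open>2 * x\<^sup>2\<close>.\<close>
    have *: "((profile b)\<^sup>2 - (profile a)\<^sup>2)\<^sup>2 \<le>
        8 * (profile c)\<^sup>2 * ((profile b)\<^sup>2 + (profile a)\<^sup>2 - 2 * (profile c)\<^sup>2 + 2 * x\<^sup>2)"
      using two_point_aux[of x c] that unfolding ab by (auto simp: c_def x_def)
    have "2 * sqrt ((profile c)\<^sup>2) \<le> sqrt ((profile b)\<^sup>2 + x\<^sup>2) + sqrt ((profile a)\<^sup>2 + x\<^sup>2)"
      using * by (intro two_sqrt_le_sqrt_add_sqrt) (auto simp: algebra_simps)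
    moreover have "x\<^sup>2 = ((a - b) / 2)\<^sup>2" by (simp add: x_def power2_eq_square field_simps)
    ultimately show ?thesis
      using profile_pos[of c] by (simp add: c_def add.commute)
  qed
  have main': "profile ((a + b) / 2) \<le>
    (sqrt ((profile a)\<^sup>2 + ((a - b) / 2)\<^sup>2) + sqrt ((profile b)\<^sup>2 + ((a - b) / 2)\<^sup>2)) / 2"
    if "0 < a" "0 < b" "a + b \<le> 1" for a b
    using main[of a b] main[of b a] that
    by (cases "a \<le> b") (auto simp: add.commute power2_commute[of a b] power_divide)
  show ?thesis
  proof (cases "a + b \<le> 1")
    case True
    then show ?thesis using main' assms by auto
  next
    case False
    \<comment> \<open>The profile is symmetric about 1/2, so the reflection \<open>s\<close> to
      \<open>1 - s\<close> brings the midpoint back to the range of \<open>main'\<close>.\<close>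
    have "((1 - a) + (1 - b)) / 2 = 1 - (a + b) / 2" by (simp add: field_simps)
    then have "profile ((a + b) / 2) = profile (((1 - a) + (1 - b)) / 2)"
      using profile_one_minus[of "(a + b) / 2"] assms by (simp only:) simp
    then show ?thesis
      using main'[of "1 - a" "1 - b"] assms False
      by (simp add: profile_one_minus power2_commute[of a b] power_divide)
  qed
qed

section \<open>Bobkov's inequality on the line\<close>

text \<open>Approximate differentiability with a quadratic error term is stable under averaging, which spares
  every differentiation under the integral sign.\<close>

definition smooth :: "real \<Rightarrow> ('a::euclidean_space \<Rightarrow> real) \<Rightarrow> ('a \<Rightarrow> 'a) \<Rightarrow> bool" where
  "smooth L f G \<longleftrightarrow>
     (\<forall>x h. \<bar>f (x + h) - f x - G x \<bullet> h\<bar> \<le> L * (norm h)\<^sup>2) \<and>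
     (\<forall>x y. norm (G x - G y) \<le> L * norm (x - y)) \<and> (\<forall>x. norm (G x) \<le> L)"

lemma smoothD:
  assumes "smooth L f G"
  shows "\<bar>f (x + h) - f x - G x \<bullet> h\<bar> \<le> L * (norm h)\<^sup>2"
    and "norm (G x - G y) \<le> L * norm (x - y)"
    and "norm (G x) \<le> L"
    and "0 \<le> L"
proof -
  show "\<bar>f (x + h) - f x - G x \<bullet> h\<bar> \<le> L * (norm h)\<^sup>2" "norm (G x - G y) \<le> L * norm (x - y)"
    using assms by (auto simp: smooth_def)
  have "norm (G x) \<le> L" for x using assms by (auto simp: smooth_def)
  then show "norm (G x) \<le> L" "0 \<le> L"
    using order_trans[OF norm_ge_zero] by blast+
qed

lemma smooth_imp_continuous:
  assumes "smooth L f G"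
  shows "continuous_on A f" "continuous_on A G"
proof -
  have "(f has_derivative (\<lambda>h. G x \<bullet> h)) (at x)" for x
  proof -
    have "(\<lambda>h. norm (f (x + h) - f x - G x \<bullet> h) / norm h) \<midarrow>0\<rightarrow> 0"
    proof (rule Lim_null_comparison)
      show "\<forall>\<^sub>F h in at 0. norm (norm (f (x + h) - f x - G x \<bullet> h) / norm h) \<le> L * norm h"
        using smoothD(1)[OF assms, of x] smoothD(4)[OF assms]
        by (intro always_eventually allI)
           (auto simp: divide_le_eq power2_eq_square mult.assoc)
      show "((\<lambda>h. L * norm h) \<longlongrightarrow> 0) (at 0)"
        by (auto intro!: tendsto_eq_intros)
    qed
    then show ?thesis
      unfolding has_derivative_at by (simp add: bounded_linear_inner_right)
  qed
  then show "continuous_on A f"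
    by (meson continuous_at_imp_continuous_on has_derivative_continuous)
  show "continuous_on A G"
  proof -
    have "L-lipschitz_on A G"
      by (intro lipschitz_onI) (auto simp: dist_norm smoothD[OF assms])
    then show ?thesis by (rule lipschitz_on_continuous_on)
  qed
qed

lemma continuous_on_profile_comp:
  assumes "continuous_on A f" "\<And>x. x \<in> A \<Longrightarrow> 0 < f x \<and> f x < (1::real)"
  shows "continuous_on A (\<lambda>x. profile (f x))"
  using assms by (intro continuous_on_compose2[OF continuous_on_profile]) auto

lemma sqrt_sq_add_sq_mono:
  "0 \<le> a \<Longrightarrow> a \<le> a' \<Longrightarrow> 0 \<le> b \<Longrightarrow> b \<le> b' \<Longrightarrow> sqrt (a\<^sup>2 + b\<^sup>2) \<le> sqrt (a'\<^sup>2 + (b'::real)\<^sup>2)"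
  by (intro real_sqrt_le_mono add_mono power_mono) auto

text \<open>The root is the norm of the pair \<open>(u x, w x)\<close> in a product space, so this
  is the norm bound for a vector-valued integral. It is what makes Bobkov's inequality
  tensorise.\<close>

lemma sqrt_sq_add_sq_le_integral:
  fixes u :: "'b \<Rightarrow> real" and w :: "'b \<Rightarrow> 'c::euclidean_space"
  assumes u: "integrable M u" and w: "integrable M w"
  shows "sqrt ((\<integral>x. u x \<partial>M)\<^sup>2 + (norm (\<integral>x. w x \<partial>M))\<^sup>2) \<le> (\<integral>x. sqrt ((u x)\<^sup>2 + (norm (w x))\<^sup>2) \<partial>M)"
proof -
  have i: "integrable M (\<lambda>x. (u x, w x))"
    by (rule Bochner_Integration.integrable_bound[where f = "\<lambda>x. norm (u x) + norm (w x)"])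
       (use u w norm_Pair_le[of "u _" "w _"] in \<open>auto intro!: borel_measurable_Pair AE_I2 order_trans[OF norm_Pair_le]\<close>)
  have "fst (\<integral>x. (u x, w x) \<partial>M) = (\<integral>x. u x \<partial>M)" "snd (\<integral>x. (u x, w x) \<partial>M) = (\<integral>x. w x \<partial>M)"
    using integral_bounded_linear[OF bounded_linear_fst i] integral_bounded_linear[OF bounded_linear_snd i]
    by simp_all
  then have "(\<integral>x. (u x, w x) \<partial>M) = ((\<integral>x. u x \<partial>M), (\<integral>x. w x \<partial>M))"
    by (simp add: prod_eq_iff)
  then show ?thesis
    using integral_norm_bound[of M "\<lambda>x. (u x, w x)"] by (simp add: norm_Pair)
qed

section \<open>Random walk and central limit theorem\<close>

primrec walk :: "real \<Rightarrow> nat \<Rightarrow> real pmf" where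
  "walk h 0 = return_pmf 0"
| "walk h (Suc n) = bind_pmf (walk h n) (\<lambda>x. map_pmf (\<lambda>b. if b then x + h else x - h) (bernoulli_pmf (1/2)))"

text \<open>The codomain is general because real functions as well as complex exponentials are
  averaged.\<close>

definition avg :: "real \<Rightarrow> (real \<Rightarrow> 'b) \<Rightarrow> real \<Rightarrow> 'b::{banach, second_countable_topology}" where
  "avg h f x = (1/2) *\<^sub>R (f (x + h) + f (x - h))"

lemma finite_set_walk: "finite (set_pmf (walk h n))"
  by (induction n) auto

text \<open>The last step is averaged out first, which matches the induction on the number of steps.
  The walk has finite support, so integrability is automatic.\<close>

lemma expectation_walk_Suc:
  "measure_pmf.expectation (walk h (Suc n)) f = measure_pmf.expectation (walk h n) (avg h f)"
proof -
  have *: "measure_pmf.expectation (bernoulli_pmf (1/2)) (\<lambda>b. f (if b then x + h else x - h)) = avg h f x" for x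
    by (simp add: avg_def integral_measure_pmf[of UNIV] UNIV_bool scaleR_add_right)
  show ?thesis
    by (simp add: pmf_expectation_bind[OF finite_set_walk _ order_refl] *
        integral_measure_pmf[OF finite_set_walk, where M = "walk h n"])
qed

text \<open>Exponentials are eigenfunctions of \<open>avg h\<close> with eigenvalue
  \<open>cos (t * h)\<close>.\<close>

lemma char_walk: "char (distr (walk h n) borel (\<lambda>x. x)) t = complex_of_real (cos (t * h) ^ n)"
proof -
  have *: "measure_pmf.expectation (walk h n) (\<lambda>x. iexp (t * x)) = complex_of_real (cos (t * h) ^ n)" for n
  proof (induction n)
    case (Suc n)
    have "avg h (\<lambda>x. iexp (t * x)) = (\<lambda>x. complex_of_real (cos (t * h)) * iexp (t * x))"
      by (auto simp: avg_def fun_eq_iff complex_eq_iff Re_exp Im_exp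
          ring_distribs cos_add cos_diff sin_add sin_diff)
    then show ?case
      using Suc by (subst expectation_walk_Suc) simp
  qed simp
  show ?thesis
    unfolding char_def using *[of n] by (subst integral_distr) auto
qed

text \<open>By Levy's continuity theorem it suffices that the \<open>n\<close>-th power of
  \<open>cos (t / sqrt n)\<close> tends to \<open>exp (- t\<^sup>2 / 2)\<close>. Replacing the
  cosine by \<open>1 - t\<^sup>2 / (2 * n)\<close> costs at most \<open>n\<close> times a cubic
  error of order \<open>n powr (-3/2)\<close>.\<close>

lemma weak_conv_walk:
  "weak_conv_m (\<lambda>n. distr (walk (1 / sqrt (real n)) n) borel (\<lambda>x. x)) std_normal_distribution"
proof (rule levy_continuity)
  show "real_distribution (distr (walk (1 / sqrt (real n)) n) borel (\<lambda>x. x))" for n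
    by (intro real_distribution.intro real_distribution_axioms.intro measure_pmf.prob_space_distr) auto
  show "real_distribution std_normal_distribution" by (rule real_dist_normal_dist)
  fix t :: real
  have cos: "\<bar>cos u - (1 - u\<^sup>2 / 2)\<bar> \<le> \<bar>u\<bar> ^ 3" for u :: real
  proof -
    obtain s where s: "cos u = (\<Sum>m<3. cos_coeff m * u ^ m) + cos (s + 1/2 * real 3 * pi) / fact 3 * u ^ 3"
      using Maclaurin_cos_expansion[of u 3] by blast
    have "\<bar>cos u - (1 - u\<^sup>2 / 2)\<bar> = \<bar>cos (s + 1/2 * real 3 * pi)\<bar> / 6 * \<bar>u\<bar> ^ 3"
      unfolding s by (simp add: numeral_eq_Suc cos_coeff_def abs_mult power_abs fact_numeral)
    also have "\<dots> \<le> 1 * \<bar>u\<bar> ^ 3"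
      by (intro mult_right_mono) (auto intro: order_trans[OF abs_cos_le_one])
    finally show ?thesis by simp
  qed
  have "(\<lambda>n. \<bar>t\<bar> ^ 3 / sqrt n) \<longlonglongrightarrow> 0"
    by (rule tendsto_divide_0[OF tendsto_const filterlim_at_top_imp_at_infinity
          [OF filterlim_compose[OF sqrt_at_top filterlim_real_sequentially]]])
  moreover have "\<forall>\<^sub>F n in sequentially.
     norm (cos (t * (1 / sqrt (real n))) ^ n - (1 + (- t\<^sup>2 / 2) / n) ^ n) \<le> \<bar>t\<bar> ^ 3 / sqrt n"
    \<comment> \<open>For \<open>t\<^sup>2 \<le> n\<close> both bases have modulus at most 1, as
      \<open>norm_power_diff\<close> requires.\<close>
    using eventually_ge_at_top[of "nat \<lceil>t\<^sup>2\<rceil> + 1"]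
  proof eventually_elim
    case (elim n)
    define u where "u = t / sqrt n"
    have n: "t\<^sup>2 \<le> real n" "0 < real n" using elim by linarith+
    have u2: "u\<^sup>2 = t\<^sup>2 / n" using n by (simp add: u_def power_divide)
    then have u1: "u\<^sup>2 \<le> 1" "0 \<le> u\<^sup>2" using n by auto
    have "norm (cos u ^ n - (1 - u\<^sup>2 / 2) ^ n) \<le> n * norm (cos u - (1 - u\<^sup>2 / 2))"
      by (rule norm_power_diff) (use u1 in \<open>auto simp: abs_le_iff\<close>)
    also have "\<dots> \<le> n * \<bar>u\<bar> ^ 3"
      using cos[of u] by (intro mult_left_mono) auto
    also have "\<bar>u\<bar> ^ 3 = \<bar>t\<bar> ^ 3 / (n * sqrt n)"
      using n by (simp add: u_def power_divide power3_eq_cube)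
    finally show ?case
      using n by (simp add: u_def power_divide mult.commute)
  qed
  ultimately have "(\<lambda>n. cos (t * (1 / sqrt (real n))) ^ n - (1 + (- t\<^sup>2 / 2) / n) ^ n) \<longlonglongrightarrow> 0"
    by (rule Lim_null_comparison[rotated])
  from tendsto_add[OF this tendsto_exp_limit_sequentially[of "- t\<^sup>2 / 2"]]
  have "(\<lambda>n. cos (t * (1 / sqrt (real n))) ^ n) \<longlonglongrightarrow> exp (- t\<^sup>2 / 2)"
    by simp
  then have "(\<lambda>n. complex_of_real (cos (t * (1 / sqrt (real n))) ^ n)) \<longlonglongrightarrow> complex_of_real (exp (- t\<^sup>2 / 2))"
    by (rule tendsto_of_real)
  then show "(\<lambda>n. char (distr (walk (1 / sqrt (real n)) n) borel (\<lambda>x. x)) t) \<longlonglongrightarrow> char std_normal_distribution t"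
    by (simp only: char_walk char_std_normal_distribution)
qed

lemma avg_norm_diff:
  assumes "\<And>x y. norm (G x - G y) \<le> L * norm (x - y)"
  shows "norm (avg h G x - avg h G y) \<le> L * norm (x - y)"
proof -
  have "avg h G x - avg h G y = (1/2) *\<^sub>R ((G (x + h) - G (y + h)) + (G (x - h) - G (y - h)))"
    by (simp add: avg_def algebra_simps)
  then have "norm (avg h G x - avg h G y) = (1/2) * norm ((G (x + h) - G (y + h)) + (G (x - h) - G (y - h)))"
    by simp
  also have "\<dots> \<le> (1/2) * (L * norm ((x + h) - (y + h)) + L * norm ((x - h) - (y - h)))"
    by (intro mult_left_mono order_trans[OF norm_triangle_ineq] add_mono assms) auto
  finally show ?thesis by simp
qed

lemma smooth_avg:
  fixes f :: "real \<Rightarrow> real"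
  assumes "smooth L f g"
  shows "smooth L (avg h f) (avg h g)"
  unfolding smooth_def
proof (intro conjI allI)
  fix x k y :: real
  have "avg h f (x + k) - avg h f x - avg h g x \<bullet> k =
    ((f (x + h + k) - f (x + h) - g (x + h) \<bullet> k) + (f (x - h + k) - f (x - h) - g (x - h) \<bullet> k)) / 2"
    by (simp add: avg_def field_simps)
  then have "\<bar>avg h f (x + k) - avg h f x - avg h g x \<bullet> k\<bar> =
    \<bar>(f (x + h + k) - f (x + h) - g (x + h) \<bullet> k) + (f (x - h + k) - f (x - h) - g (x - h) \<bullet> k)\<bar> / 2"
    by (simp only: abs_divide abs_numeral)
  also have "\<dots> \<le> (L * (norm k)\<^sup>2 + L * (norm k)\<^sup>2) / 2"
    by (intro divide_right_mono order_trans[OF abs_triangle_ineq] add_mono smoothD[OF assms]) auto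
  finally show "\<bar>avg h f (x + k) - avg h f x - avg h g x \<bullet> k\<bar> \<le> L * (norm k)\<^sup>2" by simp
  show "norm (avg h g x - avg h g y) \<le> L * norm (x - y)"
    by (rule avg_norm_diff) (rule smoothD[OF assms])
  have "norm (avg h g x) \<le> (norm (g (x + h)) + norm (g (x - h))) / 2"
    by (auto simp: avg_def)
  then show "norm (avg h g x) \<le> L"
    using smoothD(3)[OF assms, of "x + h"] smoothD(3)[OF assms, of "x - h"] by simp
qed

text \<open>Each step of the walk contributes one summand
  \<open>h\<^sup>2 * (\<bar>g x\<bar> + 2 * L * h)\<^sup>2\<close> under the root, through the
  two-point inequality. The induction hypothesis is applied to \<open>avg h f\<close>, which is
  \<open>smooth\<close> with the same \<open>L\<close>.\<close>

lemma walk_profile_inequality: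
  fixes f g :: "real \<Rightarrow> real"
  assumes "smooth L f g" "\<And>x. 0 < f x \<and> f x < 1" "0 \<le> h"
  shows "profile (measure_pmf.expectation (walk h n) f) \<le>
    measure_pmf.expectation (walk h n) (\<lambda>x. sqrt ((profile (f x))\<^sup>2 + n * h\<^sup>2 * (\<bar>g x\<bar> + 2 * L * h)\<^sup>2))"
  using assms(1,2)
proof (induction n arbitrary: f g)
  case 0
  then show ?case using profile_pos[of "f 0"] by simp
next
  case (Suc n)
  define c where "c x = \<bar>g x\<bar> + 2 * L * h" for x
  have L: "0 \<le> L" using smoothD(4)[OF Suc.prems(1)] .
  have c: "0 \<le> c x" for x using L \<open>0 \<le> h\<close> by (simp add: c_def)
  define w where "w x = sqrt ((profile (f x))\<^sup>2 + h\<^sup>2 * (c x)\<^sup>2)" for x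
  have w: "0 \<le> w x" for x by (simp add: w_def)
  define F where "F x = sqrt ((w x)\<^sup>2 + n * h\<^sup>2 * (c x)\<^sup>2)" for x
  have av: "avg h u x = (u (x + h) + u (x - h)) / 2" for u :: "real \<Rightarrow> real" and x
    by (simp add: avg_def)
  have rng: "0 < avg h f x \<and> avg h f x < 1" for x
    using Suc.prems(2)[of "x + h"] Suc.prems(2)[of "x - h"] by (simp add: av)
  have "profile (measure_pmf.expectation (walk h (Suc n)) f) = profile (measure_pmf.expectation (walk h n) (avg h f))"
    by (simp only: expectation_walk_Suc)
  also have "\<dots> \<le> measure_pmf.expectation (walk h n)
      (\<lambda>x. sqrt ((profile (avg h f x))\<^sup>2 + n * h\<^sup>2 * (\<bar>avg h g x\<bar> + 2 * L * h)\<^sup>2))"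
    by (rule Suc.IH) (use smooth_avg[OF Suc.prems(1)] rng in auto)
  also have "\<dots> \<le> measure_pmf.expectation (walk h n) (avg h F)"
  proof (intro integral_mono integrable_measure_pmf_finite finite_set_walk)
    fix x
    \<comment> \<open>Origin of the correction \<open>2 * L * h\<close>: the expansion is taken at
      an endpoint with increment of length \<open>2 * h\<close>, so the quadratic error is
      \<open>4 * L * h\<^sup>2\<close>.\<close>
    have d1: "\<bar>f (x + h) - f (x - h)\<bar> \<le> 2 * h * c (x + h)"
    proof -
      have "\<bar>f (x - h) - f (x + h) + 2 * h * g (x + h)\<bar> \<le> 4 * L * h\<^sup>2"
        using smoothD(1)[OF Suc.prems(1), of "x + h" "- 2 * h"] by (simp add: algebra_simps)
      moreover have "\<bar>2 * h * g (x + h)\<bar> = 2 * h * \<bar>g (x + h)\<bar>" using \<open>0 \<le> h\<close> by (simp add: abs_mult)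
      ultimately show ?thesis by (simp add: c_def algebra_simps power2_eq_square)
    qed
    have d2: "\<bar>f (x + h) - f (x - h)\<bar> \<le> 2 * h * c (x - h)"
    proof -
      have "\<bar>f (x + h) - f (x - h) - 2 * h * g (x - h)\<bar> \<le> 4 * L * h\<^sup>2"
        using smoothD(1)[OF Suc.prems(1), of "x - h" "2 * h"] by (simp add: algebra_simps)
      moreover have "\<bar>2 * h * g (x - h)\<bar> = 2 * h * \<bar>g (x - h)\<bar>" using \<open>0 \<le> h\<close> by (simp add: abs_mult)
      ultimately show ?thesis by (simp add: c_def algebra_simps power2_eq_square)
    qed
    have sq: "((f (x + h) - f (x - h)) / 2)\<^sup>2 \<le> h\<^sup>2 * (c y)\<^sup>2" if "\<bar>f (x + h) - f (x - h)\<bar> \<le> 2 * h * c y" for y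
    proof -
      have "\<bar>(f (x + h) - f (x - h)) / 2\<bar> \<le> \<bar>h * c y\<bar>" using that by auto
      then have "((f (x + h) - f (x - h)) / 2)\<^sup>2 \<le> (h * c y)\<^sup>2" by (simp only: abs_le_square_iff)
      then show ?thesis by (simp add: power_mult_distrib)
    qed
    have "profile (avg h f x) \<le> avg h w x"
      unfolding av w_def using Suc.prems(2) sq[OF d1] sq[OF d2]
      by (intro order_trans[OF two_point_inequality] divide_right_mono add_mono real_sqrt_le_mono) auto
    moreover have "\<bar>avg h g x\<bar> + 2 * L * h \<le> avg h c x"
      by (simp add: av c_def)
    ultimately have "sqrt ((profile (avg h f x))\<^sup>2 + n * h\<^sup>2 * (\<bar>avg h g x\<bar> + 2 * L * h)\<^sup>2)
        \<le> sqrt ((avg h w x)\<^sup>2 + n * h\<^sup>2 * (avg h c x)\<^sup>2)"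
      using profile_pos[of "avg h f x"] L \<open>0 \<le> h\<close>
      by (intro real_sqrt_le_mono add_mono power_mono mult_left_mono) auto
    \<comment> \<open>Read as a Euclidean norm in the plane, so that the average over the two
      endpoints can be taken outside by the triangle inequality.\<close>
    also have "\<dots> = sqrt ((avg h w x)\<^sup>2 + (sqrt n * h * avg h c x)\<^sup>2)"
      by (simp add: power_mult_distrib)
    also have "\<dots> = norm (avg h w x, sqrt n * h * avg h c x)"
      by (simp add: norm_Pair)
    also have "(avg h w x, sqrt n * h * avg h c x) =
        (1/2) *\<^sub>R ((w (x + h), sqrt n * h * c (x + h)) + (w (x - h), sqrt n * h * c (x - h)))"
      by (simp add: av algebra_simps add_divide_distrib)
    also have "norm \<dots> \<le> (1/2) * (norm (w (x + h), sqrt n * h * c (x + h)) + norm (w (x - h), sqrt n * h * c (x - h)))"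
      by (simp only: norm_scaleR)
         (use norm_triangle_ineq[of "(w (x + h), sqrt n * h * c (x + h))" "(w (x - h), sqrt n * h * c (x - h))"] in simp)
    also have "\<dots> = avg h F x"
      by (simp add: av F_def norm_Pair power_mult_distrib)
    finally show "sqrt ((profile (avg h f x))\<^sup>2 + n * h\<^sup>2 * (\<bar>avg h g x\<bar> + 2 * L * h)\<^sup>2) \<le> avg h F x" .
  qed
  also have "\<dots> = measure_pmf.expectation (walk h (Suc n)) F"
    by (simp only: expectation_walk_Suc)
  also have "F = (\<lambda>x. sqrt ((profile (f x))\<^sup>2 + Suc n * h\<^sup>2 * (\<bar>g x\<bar> + 2 * L * h)\<^sup>2))"
    by (simp add: fun_eq_iff F_def w_def c_def algebra_simps)
  finally show ?case .
qed

text \<open>Strictness matters: \<open>quantile\<close> and \<open>profile\<close> are continuous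
  and differentiable only inside the open unit interval.\<close>

lemma expectation_in_unit:
  assumes "prob_space M" "f \<in> borel_measurable M" "\<And>x. 0 < f x \<and> f x < (1::real)"
  shows "0 < (\<integral>x. f x \<partial>M) \<and> (\<integral>x. f x \<partial>M) < 1"
proof -
  interpret prob_space M by fact
  have i: "integrable M f"
    by (rule integrable_const_bound[where B = 1]) (use assms in \<open>auto intro!: AE_I2 simp: less_imp_le abs_less_iff\<close>)
  have "(\<integral>x. 0 \<partial>M) < (\<integral>x. f x \<partial>M)" "(\<integral>x. f x \<partial>M) < (\<integral>x. 1 \<partial>M)"
    by (rule integral_less_AE_space; use i assms(3) emeasure_space_1 in simp)+
  then show ?thesis by (simp add: prob_space)
qed

text \<open>With step \<open>1 / sqrt n\<close> the factor \<open>n * h\<^sup>2\<close> is 1 and the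
  correction \<open>2 * L * h\<close> vanishes in the limit. Both sides converge because
  \<open>f\<close> and the root are bounded and continuous and \<open>profile\<close> is continuous
  at the mean of \<open>f\<close>.\<close>

lemma bobkov_real:
  fixes f g :: "real \<Rightarrow> real"
  assumes s: "smooth L f g" and f: "\<And>x. 0 < f x \<and> f x < 1"
  shows "profile (\<integral>x. f x \<partial>std_normal_distribution) \<le>
    (\<integral>x. sqrt ((profile (f x))\<^sup>2 + (g x)\<^sup>2) \<partial>std_normal_distribution)"
proof -
  define W where "W = (\<lambda>n. walk (1 / sqrt (real n)) n)"
  define u where "u x = sqrt ((profile (f x))\<^sup>2 + (g x)\<^sup>2)" for x
  have L: "0 \<le> L" using smoothD(4)[OF s] .
  have cont: "continuous_on UNIV f" "continuous_on UNIV u"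
    unfolding u_def using f smooth_imp_continuous[OF s]
    by (auto intro!: continuous_intros continuous_on_profile_comp)
  have bu: "\<bar>u x\<bar> \<le> 1 + L" for x
  proof -
    have "u x \<le> \<bar>profile (f x)\<bar> + \<bar>g x\<bar>" unfolding u_def by (rule sqrt_sum_squares_le_sum_abs)
    then show ?thesis
      using profile_pos[of "f x"] profile_le_1[of "f x"] smoothD(3)[OF s, of x] by (simp add: u_def)
  qed
  have conv: "(\<lambda>n. measure_pmf.expectation (W n) k) \<longlonglongrightarrow> (\<integral>x. k x \<partial>std_normal_distribution)"
    if k: "continuous_on UNIV k" "\<And>x. norm (k x) \<le> B" for k :: "real \<Rightarrow> real" and B
  proof -
    have "(\<lambda>n. integral\<^sup>L (distr (W n) borel (\<lambda>x. x)) k) \<longlonglongrightarrow> integral\<^sup>L std_normal_distribution k"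
      unfolding W_def
    proof (rule weak_conv_imp_integral_bdd_continuous_conv)
      show "real_distribution (distr (walk (1 / sqrt (real n)) n) borel (\<lambda>x. x))" for n :: nat
        by (intro real_distribution.intro real_distribution_axioms.intro measure_pmf.prob_space_distr) auto
      show "real_distribution std_normal_distribution" by (rule real_dist_normal_dist)
      show "weak_conv_m (\<lambda>n. distr (walk (1 / sqrt (real n)) n) borel (\<lambda>x. x)) std_normal_distribution"
        by (rule weak_conv_walk)
    qed (use k in \<open>auto simp: continuous_on_eq_continuous_at\<close>)
    moreover have "integral\<^sup>L (distr (W n) borel (\<lambda>x. x)) k = measure_pmf.expectation (W n) k" for n
      using k(1) by (subst integral_distr) (auto intro: borel_measurable_continuous_onI)
    ultimately show ?thesis by simp
  qed
  have "(\<lambda>n. measure_pmf.expectation (W n) f) \<longlonglongrightarrow> (\<integral>x. f x \<partial>std_normal_distribution)"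
    by (rule conv[where B = 1]) (use f cont in \<open>auto simp: less_imp_le abs_less_iff\<close>)
  moreover have "isCont profile (\<integral>x. f x \<partial>std_normal_distribution)"
    using expectation_in_unit[OF std_normal.prob_space_axioms, of f] f cont(1)
    by (intro DERIV_isCont[OF has_real_derivative_profile]) (auto intro: borel_measurable_continuous_onI)
  ultimately have lhs: "(\<lambda>n. profile (measure_pmf.expectation (W n) f)) \<longlonglongrightarrow>
      profile (\<integral>x. f x \<partial>std_normal_distribution)"
    by (rule isCont_tendsto_compose[rotated])
  have "(\<lambda>n. 2 * L / sqrt (real n)) \<longlonglongrightarrow> 0"
    by (rule tendsto_divide_0[OF tendsto_const filterlim_at_top_imp_at_infinity
          [OF filterlim_compose[OF sqrt_at_top filterlim_real_sequentially]]])
  then have rhs: "(\<lambda>n. measure_pmf.expectation (W n) u + 2 * L / sqrt (real n)) \<longlonglongrightarrow>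
      (\<integral>x. u x \<partial>std_normal_distribution) + 0"
    using cont bu by (intro tendsto_add conv[where B = "1 + L"]) auto
  have "profile (\<integral>x. f x \<partial>std_normal_distribution) \<le> (\<integral>x. u x \<partial>std_normal_distribution) + 0"
  proof (rule tendsto_le[OF _ rhs lhs])
    show "\<forall>\<^sub>F n in sequentially. profile (measure_pmf.expectation (W n) f) \<le>
        measure_pmf.expectation (W n) u + 2 * L / sqrt (real n)"
      using eventually_gt_at_top[of 0]
    proof eventually_elim
      case (elim n)
      define h where "h = 1 / sqrt (real n)"
      have h: "0 \<le> h" "n * h\<^sup>2 = 1" using elim by (simp_all add: h_def power_divide)
      have "profile (measure_pmf.expectation (W n) f) \<le>
        measure_pmf.expectation (W n) (\<lambda>x. sqrt ((profile (f x))\<^sup>2 + n * h\<^sup>2 * (\<bar>g x\<bar> + 2 * L * h)\<^sup>2))"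
        unfolding W_def h_def[symmetric] by (rule walk_profile_inequality[OF s f h(1)])
      also have "\<dots> \<le> measure_pmf.expectation (W n) (\<lambda>x. u x + 2 * L * h)"
      proof (intro integral_mono integrable_measure_pmf_finite)
        fix x
        \<comment> \<open>The correction is split off as a vector in the plane, where the triangle
          inequality makes it additive.\<close>
        have "sqrt ((profile (f x))\<^sup>2 + n * h\<^sup>2 * (\<bar>g x\<bar> + 2 * L * h)\<^sup>2) =
            norm ((profile (f x), \<bar>g x\<bar>) + (0::real, 2 * L * h))"
          by (simp add: h norm_Pair)
        also have "\<dots> \<le> norm (profile (f x), \<bar>g x\<bar>) + norm (0::real, 2 * L * h)"
          by (rule norm_triangle_ineq)
        also have "\<dots> = u x + 2 * L * h"
          using L h by (simp add: norm_Pair u_def)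
        finally show "sqrt ((profile (f x))\<^sup>2 + n * h\<^sup>2 * (\<bar>g x\<bar> + 2 * L * h)\<^sup>2) \<le> u x + 2 * L * h" .
      qed (simp_all add: W_def finite_set_walk)
      also have "\<dots> = measure_pmf.expectation (W n) u + 2 * L * h"
        by (subst Bochner_Integration.integral_add)
           (auto intro: integrable_measure_pmf_finite simp: W_def finite_set_walk)
      finally show ?case by (simp add: h_def)
    qed
  qed simp
  then show ?thesis by (simp add: u_def)
qed

section \<open>Tensorisation\<close>

text \<open>Filling the missing coordinates with 0 keeps all vectors in one fixed space, so that the
  tensorisation can run over sets of coordinates. Applied to \<open>($) v\<close>, it is the
  orthogonal projection of \<open>v\<close> onto the coordinates in \<open>J\<close>.\<close>

definition coords :: "'n set \<Rightarrow> ('n \<Rightarrow> real) \<Rightarrow> real ^ 'n" where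
  "coords J w = (\<chi> i. if i \<in> J then w i else 0)"

lemma norm_coords_sq: "finite J \<Longrightarrow> (norm (coords J w))\<^sup>2 = (\<Sum>i\<in>J. (w i)\<^sup>2)"
  for J :: "'n::finite set"
proof -
  have "(norm (coords J w))\<^sup>2 = (\<Sum>i\<in>UNIV. if i \<in> J then (w i)\<^sup>2 else 0)"
    unfolding power2_norm_eq_inner inner_vec_def coords_def
    by (intro sum.cong) (auto simp: power2_eq_square)
  also have "\<dots> = (\<Sum>i\<in>J. (w i)\<^sup>2)"
    by (simp add: sum.If_cases)
  finally show ?thesis .
qed

lemma measurable_coords [measurable]:
  "coords J \<in> borel_measurable (Pi\<^sub>M J (\<lambda>_. std_normal_distribution))" for J :: "'n::finite set"
proof (subst borel_measurable_euclidean_space, intro ballI)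
  fix b :: "real ^ 'n" assume "b \<in> Basis"
  then obtain k where b: "b = axis k 1" by (auto simp: Basis_vec_def)
  have "(\<lambda>w. coords J w \<bullet> b) = (\<lambda>w. if k \<in> J then w k else 0)"
    by (simp add: b inner_axis coords_def fun_eq_iff)
  moreover have "(\<lambda>w. w k) \<in> borel_measurable (Pi\<^sub>M J (\<lambda>_. std_normal_distribution))" if "k \<in> J"
    using measurable_component_singleton[OF that, of "\<lambda>_. std_normal_distribution"]
    by (simp cong: measurable_cong_sets)
  ultimately show "(\<lambda>w. coords J w \<bullet> b) \<in> borel_measurable (Pi\<^sub>M J (\<lambda>_. std_normal_distribution))"
    by (cases "k \<in> J") auto
qed

lemma coords_insert_upd:
  "j \<notin> J \<Longrightarrow> coords (insert j J) (w(j := z)) = coords J w + z *\<^sub>R axis j 1"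
  by (auto simp: coords_def vec_eq_iff axis_def)

lemma norm_coords_le: "norm (coords J (($) v)) \<le> norm v"
  by (rule norm_le_componentwise_cart) (auto simp: coords_def)

lemma bounded_linear_coords: "bounded_linear (\<lambda>v. coords J (($) v))" for J :: "'n::finite set"
  unfolding linear_conv_bounded_linear[symmetric]
  by (rule linearI) (auto simp: coords_def vec_eq_iff)

interpretation std_normal_product: product_sigma_finite "\<lambda>_. std_normal_distribution"
  by standard

lemma prob_space_PiM_std_normal: "prob_space (Pi\<^sub>M J (\<lambda>_. std_normal_distribution))"
  by (rule prob_space_PiM) (rule std_normal.prob_space_axioms)

text \<open>Turns the measure given by a density into a product of normal laws, which gives access
  to Fubini's theorem and to product integrals.\<close>

lemma std_gaussian_eq_distr:
  "std_gaussian = distr (Pi\<^sub>M UNIV (\<lambda>_. std_normal_distribution)) borel (coords (UNIV :: 'n::finite set))"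
proof -
  have [measurable]: "(\<lambda>x i. x $ i) \<in> (borel :: (real ^ 'n) measure) \<rightarrow>\<^sub>M Pi\<^sub>M UNIV (\<lambda>_. std_normal_distribution)"
    by (rule measurable_PiM_single') (auto simp: borel_measurable_nth cong: measurable_cong_sets)
  have "distr std_gaussian (Pi\<^sub>M UNIV (\<lambda>_. std_normal_distribution)) (\<lambda>(x :: real ^ 'n) i. x $ i)
      = Pi\<^sub>M UNIV (\<lambda>_. std_normal_distribution)"
  proof (rule std_normal_product.PiM_eqI)
    fix A :: "'n \<Rightarrow> real set" assume A: "\<And>i. i \<in> UNIV \<Longrightarrow> A i \<in> sets std_normal_distribution"
    then have [measurable]: "A i \<in> sets borel" for i by simp
    have "emeasure (distr std_gaussian (Pi\<^sub>M UNIV (\<lambda>_. std_normal_distribution)) (\<lambda>(x :: real ^ 'n) i. x $ i)) (Pi\<^sub>E UNIV A)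
        = emeasure std_gaussian {x :: real ^ 'n. \<forall>i. x $ i \<in> A i}"
      using A sets_PiM_I_finite[of UNIV A "\<lambda>_. std_normal_distribution"] by (subst emeasure_distr)
        (auto simp: std_gaussian_def PiE_UNIV_domain intro!: arg_cong[where f = "emeasure _"])
    \<comment> \<open>Written over \<open>Basis\<close> because the product formula for
      \<open>lborel\<close> is indexed by it; \<open>axis_index\<close> recovers the
      coordinate.\<close>
    also have "\<dots> = (\<integral>\<^sup>+x. (\<Prod>b\<in>Basis. ennreal (std_normal_density (x \<bullet> b) * indicator (A (axis_index b)) (x \<bullet> b))) \<partial>(lborel :: (real ^ 'n) measure))"
      unfolding std_gaussian_def
    proof (subst emeasure_density, goal_cases)
      case 3
      have inj: "inj_on (\<lambda>i::'n. axis i (1::real)) UNIV" by (auto intro!: inj_onI simp: axis_eq_axis)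
      have B: "(Basis :: (real ^ 'n) set) = range (\<lambda>i. axis i 1)" by (auto simp: Basis_vec_def)
      have *: "(\<Prod>i\<in>UNIV. ennreal (std_normal_density (x $ i) * indicator (A i) (x $ i))) =
          ennreal (\<Prod>i\<in>UNIV. std_normal_density (x $ i)) * indicator {x. \<forall>i. x $ i \<in> A i} x" for x :: "real ^ 'n"
      proof (cases "\<forall>i. x $ i \<in> A i")
        case False
        then obtain i where "x $ i \<notin> A i" by blast
        then have "(\<Prod>i\<in>UNIV. ennreal (std_normal_density (x $ i) * indicator (A i) (x $ i))) = 0"
          by (intro prod_zero) (auto intro!: exI[of _ i])
        then show ?thesis using False by simp
      qed (simp add: prod_ennreal)
      show ?case
        unfolding B
        by (intro nn_integral_cong, subst prod.reindex[OF inj])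
           (simp only: inner_axis axis_index_axis * o_def real_inner_1_right)
    qed auto
    also have "\<dots> = (\<Prod>b\<in>(Basis :: (real ^ 'n) set). \<integral>\<^sup>+x. ennreal (std_normal_density x * indicator (A (axis_index b)) x) \<partial>lborel)"
      by (subst prod_ennreal[symmetric] nn_integral_lborel_prod[symmetric]; simp add: prod_ennreal)+
    also have "\<dots> = (\<Prod>i\<in>UNIV. emeasure std_normal_distribution (A i))"
    proof -
      have inj: "inj_on (\<lambda>i::'n. axis i (1::real)) UNIV" by (auto intro!: inj_onI simp: axis_eq_axis)
      have B: "(Basis :: (real ^ 'n) set) = range (\<lambda>i. axis i 1)" by (auto simp: Basis_vec_def)
      show ?thesis
        unfolding B
        by (subst prod.reindex[OF inj])
           (auto simp: emeasure_density axis_index_axis ennreal_mult'' ennreal_indicator intro!: prod.cong)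
    qed
    finally show "emeasure (distr std_gaussian (Pi\<^sub>M UNIV (\<lambda>_. std_normal_distribution)) (\<lambda>(x :: real ^ 'n) i. x $ i)) (Pi\<^sub>E UNIV A)
        = (\<Prod>i\<in>UNIV. emeasure std_normal_distribution (A i))" .
  qed auto
  then have "distr (Pi\<^sub>M UNIV (\<lambda>_. std_normal_distribution)) borel (coords (UNIV :: 'n set)) =
      distr (distr std_gaussian (Pi\<^sub>M UNIV (\<lambda>_. std_normal_distribution)) (\<lambda>(x :: real ^ 'n) i. x $ i)) borel (coords UNIV)"
    by simp
  also have "\<dots> = distr std_gaussian borel (\<lambda>x. x)"
    by (subst distr_distr) (auto simp: std_gaussian_def o_def coords_def)
  also have "\<dots> = std_gaussian"
    by (rule distr_id2) (simp add: std_gaussian_def)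
  finally show ?thesis by simp
qed

lemma sets_std_gaussian [simp, measurable_cong]: "sets std_gaussian = sets borel"
  and space_std_gaussian [simp]: "space std_gaussian = UNIV"
  by (simp_all add: std_gaussian_def)

lemma prob_space_std_gaussian: "prob_space (std_gaussian :: (real ^ 'n::finite) measure)"
  unfolding std_gaussian_eq_distr
  by (rule prob_space.prob_space_distr[OF prob_space_PiM_std_normal]) simp

text \<open>Along a unit direction the constant is preserved, and the derivative becomes the partial
  derivative in that direction.\<close>

lemma smooth_line:
  fixes a :: "'a::euclidean_space"
  assumes s: "smooth L f G" and a: "norm a = 1"
  shows "smooth L (\<lambda>z. f (y + z *\<^sub>R a)) (\<lambda>z. G (y + z *\<^sub>R a) \<bullet> a)"
  unfolding smooth_def
proof (intro conjI allI)
  fix x h :: real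
  show "\<bar>f (y + (x + h) *\<^sub>R a) - f (y + x *\<^sub>R a) - (G (y + x *\<^sub>R a) \<bullet> a) \<bullet> h\<bar> \<le> L * (norm h)\<^sup>2"
    using smoothD(1)[OF s, of "y + x *\<^sub>R a" "h *\<^sub>R a"] a by (simp add: algebra_simps)
  have le: "\<bar>v \<bullet> a\<bar> \<le> norm v" for v using Cauchy_Schwarz_ineq2[of v a] a by simp
  show "norm (G (y + x *\<^sub>R a) \<bullet> a - G (y + h *\<^sub>R a) \<bullet> a) \<le> L * norm (x - h)"
    using order_trans[OF le[of "G (y + x *\<^sub>R a) - G (y + h *\<^sub>R a)"] smoothD(2)[OF s]] a
    by (simp add: inner_diff_left flip: scaleR_diff_left)
  show "norm (G (y + x *\<^sub>R a) \<bullet> a) \<le> L"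
    using order_trans[OF le smoothD(3)[OF s]] by simp
qed

lemma integrable_bounded_continuous:
  fixes f :: "'a::topological_space \<Rightarrow> 'b::{banach, second_countable_topology}"
  assumes "prob_space M" "sets M = sets borel" "continuous_on UNIV f" "\<And>x. norm (f x) \<le> B"
  shows "integrable M f"
proof -
  interpret prob_space M by fact
  have "f \<in> borel_measurable M"
    using assms(2,3) by (simp add: borel_measurable_continuous_onI cong: measurable_cong_sets)
  then show ?thesis
    by (intro integrable_const_bound[where B = B]) (use assms(4) in auto)
qed

text \<open>Integrating out a coordinate does not worsen \<open>L\<close>, so the induction over
  coordinates may apply its hypothesis to the partial mean. All three conditions in
  \<open>smooth\<close> are norm bounds, and these pass through a probability average.\<close>

lemma smooth_integral:
  assumes M: "prob_space M" "sets M = sets borel" and s: "smooth L f G" and f: "\<And>x. norm (f x) \<le> 1"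
    and k: "continuous_on UNIV (k :: real \<Rightarrow> 'a::euclidean_space)"
  shows "smooth L (\<lambda>x. \<integral>z. f (x + k z) \<partial>M) (\<lambda>x. \<integral>z. G (x + k z) \<partial>M)"
proof -
  interpret prob_space M by fact
  note cont = smooth_imp_continuous[OF s, of UNIV]
  have i: "integrable M (\<lambda>z. f (x + k z))" for x
    by (rule integrable_bounded_continuous[OF M, where B = 1])
       (auto intro!: continuous_on_compose2[OF cont(1)] continuous_intros k simp: f[simplified])
  have iG: "integrable M (\<lambda>z. G (x + k z))" for x
    by (rule integrable_bounded_continuous[OF M, where B = L])
       (auto intro!: continuous_on_compose2[OF cont(2)] continuous_intros k smoothD(3)[OF s])
  have bound: "norm (\<integral>z. u z \<partial>M) \<le> c" if "\<And>z. norm (u z) \<le> c" "integrable M u"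
    for u :: "real \<Rightarrow> 'c::{banach, second_countable_topology}" and c
  proof -
    have "norm (\<integral>z. u z \<partial>M) \<le> (\<integral>z. norm (u z) \<partial>M)" by (rule integral_norm_bound)
    also have "\<dots> \<le> (\<integral>z. c \<partial>M)" using that by (intro integral_mono) auto
    finally show ?thesis by (simp add: prob_space)
  qed
  show ?thesis
    unfolding smooth_def
  proof (intro conjI allI)
    fix x h y
    have "(\<integral>z. f (x + h + k z) \<partial>M) - (\<integral>z. f (x + k z) \<partial>M) - (\<integral>z. G (x + k z) \<partial>M) \<bullet> h
        = (\<integral>z. f (x + k z + h) - f (x + k z) - G (x + k z) \<bullet> h \<partial>M)"
      using i[of "x + h"] i[of x] iG[of x] by (simp add: add.assoc add.commute[of h])
    also have "norm \<dots> \<le> L * (norm h)\<^sup>2"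
      using smoothD(1)[OF s, of "x + k z" h for z] i[of "x + h"] i[of x] iG[of x]
      by (intro bound) (auto simp: add.assoc add.commute[of h])
    finally show "\<bar>(\<integral>z. f (x + h + k z) \<partial>M) - (\<integral>z. f (x + k z) \<partial>M) - (\<integral>z. G (x + k z) \<partial>M) \<bullet> h\<bar> \<le> L * (norm h)\<^sup>2"
      by simp
    have "norm (\<integral>z. G (x + k z) - G (y + k z) \<partial>M) \<le> L * norm (x - y)"
      using smoothD(2)[OF s, of "x + k z" "y + k z" for z] iG[of x] iG[of y] by (intro bound) auto
    then show "norm ((\<integral>z. G (x + k z) \<partial>M) - (\<integral>z. G (y + k z) \<partial>M)) \<le> L * norm (x - y)"
      using iG[of x] iG[of y] by simp
    show "norm (\<integral>z. G (x + k z) \<partial>M) \<le> L"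
      using smoothD(3)[OF s] iG by (intro bound)
  qed
qed

text \<open>Induction on \<open>J\<close>: the new coordinate \<open>j\<close> is integrated out,
  the hypothesis handles the mean \<open>Pf\<close>, and the one-dimensional inequality along the
  \<open>j\<close>-axis bounds \<open>profile (Pf y)\<close> from above inside the root.\<close>

lemma bobkov_PiM:
  fixes f :: "real ^ 'n::finite \<Rightarrow> real" and J :: "'n set"
  assumes "finite J" and "smooth L f G" and "\<And>x. 0 < f x \<and> f x < 1"
  shows "profile (\<integral>w. f (coords J w) \<partial>Pi\<^sub>M J (\<lambda>_. std_normal_distribution)) \<le>
    (\<integral>w. sqrt ((profile (f (coords J w)))\<^sup>2 + (norm (coords J (($) (G (coords J w)))))\<^sup>2)
       \<partial>Pi\<^sub>M J (\<lambda>_. std_normal_distribution))"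
  using assms
proof (induction J arbitrary: f G rule: finite_induct)
  case empty
  have "profile (f 0) \<ge> 0" using profile_pos less_imp_le by blast
  then show ?case
    by (simp add: PiM_empty coords_def lebesgue_integral_count_space_finite vec_eq_iff zero_vec_def[symmetric])
next
  case (insert j J)
  let ?N = "std_normal_distribution"
  let ?P = "\<lambda>J. Pi\<^sub>M J (\<lambda>_::'n. ?N)"
  define a :: "real ^ 'n" where "a = axis j 1"
  define F where "F x = sqrt ((profile (f x))\<^sup>2 + (norm (coords (insert j J) (($) (G x))))\<^sup>2)" for x
  define Pf where "Pf x = (\<integral>z. f (x + z *\<^sub>R a) \<partial>?N)" for x
  define PG where "PG x = (\<integral>z. G (x + z *\<^sub>R a) \<partial>?N)" for x
  note s = insert.prems(1) and f = insert.prems(2)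
  note N = std_normal.prob_space_axioms
  have setsN: "sets ?N = sets borel" by simp
  note cont = smooth_imp_continuous[OF s, of UNIV]
  have a: "norm a = 1" by (simp add: a_def norm_axis_1)
  have f1: "norm (f x) \<le> 1" for x using f[of x] by simp
  have sP: "smooth L Pf PG"
    unfolding Pf_def[abs_def] PG_def[abs_def]
    by (rule smooth_integral[OF N setsN s f1]) (auto intro!: continuous_intros)
  have contF: "continuous_on UNIV F"
    unfolding F_def using f cont
    by (auto intro!: continuous_intros continuous_on_profile_comp
        bounded_linear.continuous_on[OF bounded_linear_coords])
  then have [measurable]: "F \<in> borel_measurable borel" "f \<in> borel_measurable borel"
    using cont by (auto intro: borel_measurable_continuous_onI)
  have bF: "norm (F x) \<le> 1 + L" for x
  proof -
    have "F x \<le> \<bar>profile (f x)\<bar> + \<bar>norm (coords (insert j J) (($) (G x)))\<bar>"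
      unfolding F_def by (rule sqrt_sum_squares_le_sum_abs)
    also have "\<dots> \<le> 1 + L"
      using profile_pos[of "f x"] profile_le_1[of "f x"] norm_coords_le[of "insert j J" "G x"] smoothD(3)[OF s, of x]
      by simp
    finally show ?thesis by (simp add: F_def)
  qed
  have fubini: "(\<integral>w. k (coords (insert j J) w) \<partial>?P (insert j J)) = (\<integral>w. \<integral>z. k (coords J w + z *\<^sub>R a) \<partial>?N \<partial>?P J)"
    if "k \<in> borel_measurable borel" "\<And>x. norm (k x) \<le> B" for k :: "real ^ 'n \<Rightarrow> real" and B
  proof -
    interpret prob_space "?P (insert j J)" by (rule prob_space_PiM_std_normal)
    have "integrable (?P (insert j J)) (\<lambda>w. k (coords (insert j J) w))"
      using that by (intro integrable_const_bound[where B = B]) auto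
    then show ?thesis
      using insert.hyps
      by (subst std_normal_product.product_integral_insert) (simp_all add: coords_insert_upd a_def)
  qed
  interpret PJ: prob_space "?P J" by (rule prob_space_PiM_std_normal)
  have Pf: "0 < Pf x \<and> Pf x < 1" for x
    unfolding Pf_def by (rule expectation_in_unit[OF N]) (use f in auto)
  have "profile (\<integral>w. f (coords (insert j J) w) \<partial>?P (insert j J)) = profile (\<integral>w. Pf (coords J w) \<partial>?P J)"
    using fubini[of f 1] f1 by (simp add: Pf_def)
  also have "\<dots> \<le> (\<integral>w. sqrt ((profile (Pf (coords J w)))\<^sup>2 + (norm (coords J (($) (PG (coords J w)))))\<^sup>2) \<partial>?P J)"
    by (rule insert.IH[OF sP Pf])
  also have "\<dots> \<le> (\<integral>w. \<integral>z. F (coords J w + z *\<^sub>R a) \<partial>?N \<partial>?P J)"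
  proof (rule integral_mono)
    have contP: "continuous_on UNIV (\<lambda>y. sqrt ((profile (Pf y))\<^sup>2 + (norm (coords J (($) (PG y))))\<^sup>2))"
      using Pf smooth_imp_continuous[OF sP]
      by (auto intro!: continuous_intros continuous_on_profile_comp
          bounded_linear.continuous_on[OF bounded_linear_coords])
    have "norm (sqrt ((profile (Pf y))\<^sup>2 + (norm (coords J (($) (PG y))))\<^sup>2)) \<le> 1 + L" for y
    proof -
      have "sqrt ((profile (Pf y))\<^sup>2 + (norm (coords J (($) (PG y))))\<^sup>2) \<le> \<bar>profile (Pf y)\<bar> + \<bar>norm (coords J (($) (PG y)))\<bar>"
        by (rule sqrt_sum_squares_le_sum_abs)
      also have "\<dots> \<le> 1 + L"
        using profile_pos[of "Pf y"] profile_le_1[of "Pf y"] norm_coords_le[of J "PG y"] smoothD(3)[OF sP, of y]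
        by simp
      finally show ?thesis by simp
    qed
    then show "integrable (?P J) (\<lambda>w. sqrt ((profile (Pf (coords J w)))\<^sup>2 + (norm (coords J (($) (PG (coords J w)))))\<^sup>2))"
      by (intro PJ.integrable_const_bound[where B = "1 + L"]
          measurable_compose[OF measurable_coords borel_measurable_continuous_onI[OF contP]]) auto
    have iF: "integrable ?N (\<lambda>z. F (y + z *\<^sub>R a))" for y
      by (rule integrable_bounded_continuous[OF N setsN _ bF])
         (auto intro!: continuous_on_compose2[OF contF] continuous_intros)
    have "norm (\<integral>z. F (y + z *\<^sub>R a) \<partial>?N) \<le> 1 + L" for y
    proof -
      have "norm (\<integral>z. F (y + z *\<^sub>R a) \<partial>?N) \<le> (\<integral>z. norm (F (y + z *\<^sub>R a)) \<partial>?N)"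
        by (rule integral_norm_bound)
      also have "\<dots> \<le> (\<integral>z. 1 + L \<partial>?N)" using bF iF by (intro integral_mono integrable_norm) auto
      finally show ?thesis using std_normal.prob_space by simp
    qed
    then show "integrable (?P J) (\<lambda>w. \<integral>z. F (coords J w + z *\<^sub>R a) \<partial>?N)"
      by (intro PJ.integrable_const_bound[where B = "1 + L"]) auto
    fix w
    define y where "y = coords J w"
    define u where "u z = sqrt ((profile (f (y + z *\<^sub>R a)))\<^sup>2 + (G (y + z *\<^sub>R a) \<bullet> a)\<^sup>2)" for z
    define v where "v z = coords J (($) (G (y + z *\<^sub>R a)))" for z
    have contl: "continuous_on UNIV (\<lambda>z. f (y + z *\<^sub>R a))" "continuous_on UNIV (\<lambda>z. G (y + z *\<^sub>R a))"
      by (auto intro!: continuous_on_compose2[OF cont(1)] continuous_on_compose2[OF cont(2)] continuous_intros)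
    have iG: "integrable ?N (\<lambda>z. G (y + z *\<^sub>R a))"
      by (rule integrable_bounded_continuous[OF N setsN contl(2)]) (rule smoothD(3)[OF s])
    have iv: "integrable ?N v"
      unfolding v_def by (rule integrable_bounded_linear[OF bounded_linear_coords iG])
    \<comment> \<open>The squared gradient over \<open>insert j J\<close> is the squared
      \<open>j\<close>-th partial derivative, contained in \<open>u\<close>, plus the squared
      gradient over \<open>J\<close>.\<close>
    have Fu: "sqrt ((u z)\<^sup>2 + (norm (v z))\<^sup>2) = F (y + z *\<^sub>R a)" for z
      using insert.hyps by (simp add: F_def u_def v_def norm_coords_sq a_def inner_axis add.assoc)
    have contu: "continuous_on UNIV u"
      unfolding u_def using f contl by (auto intro!: continuous_intros continuous_on_profile_comp)
    have "norm (u z) \<le> 1 + L" for z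
    proof -
      have "u z \<le> sqrt ((u z)\<^sup>2 + (norm (v z))\<^sup>2)" by (rule real_sqrt_sum_squares_ge1)
      moreover have "0 \<le> u z" by (simp add: u_def)
      ultimately show ?thesis using bF[of "y + z *\<^sub>R a"] unfolding Fu by simp
    qed
    then have iu: "integrable ?N u"
      by (rule integrable_bounded_continuous[OF N setsN contu])
    have "profile (Pf y) \<le> (\<integral>z. u z \<partial>?N)"
      unfolding Pf_def u_def by (rule bobkov_real[OF smooth_line[OF s a] f])
    moreover have "coords J (($) (PG y)) = (\<integral>z. v z \<partial>?N)"
      unfolding PG_def v_def by (rule integral_bounded_linear[OF bounded_linear_coords iG, symmetric])
    ultimately have "sqrt ((profile (Pf y))\<^sup>2 + (norm (coords J (($) (PG y))))\<^sup>2)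
        \<le> sqrt ((\<integral>z. u z \<partial>?N)\<^sup>2 + (norm (\<integral>z. v z \<partial>?N))\<^sup>2)"
      using profile_pos[of "Pf y"] by (simp add: power_mono)
    also have "\<dots> \<le> (\<integral>z. F (y + z *\<^sub>R a) \<partial>?N)"
      using sqrt_sq_add_sq_le_integral[OF iu iv] by (simp add: Fu)
    finally show "sqrt ((profile (Pf (coords J w)))\<^sup>2 + (norm (coords J (($) (PG (coords J w)))))\<^sup>2)
        \<le> (\<integral>z. F (coords J w + z *\<^sub>R a) \<partial>?N)" by (simp add: y_def)
  qed
  also have "\<dots> = (\<integral>w. F (coords (insert j J) w) \<partial>?P (insert j J))"
    using fubini[of F "1 + L"] bF by simp
  finally show ?case by (simp add: F_def)
qed

theorem bobkov:
  fixes f :: "real ^ 'n::finite \<Rightarrow> real"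
  assumes s: "smooth L f G" and f: "\<And>x. 0 < f x \<and> f x < 1"
  shows "profile (\<integral>x. f x \<partial>std_gaussian) \<le>
    (\<integral>x. sqrt ((profile (f x))\<^sup>2 + (norm (G x))\<^sup>2) \<partial>std_gaussian)"
proof -
  have cont: "continuous_on UNIV (\<lambda>x. sqrt ((profile (f x))\<^sup>2 + (norm (G x))\<^sup>2))"
    using f smooth_imp_continuous[OF s] by (auto intro!: continuous_intros continuous_on_profile_comp)
  have "coords UNIV (($) v) = v" for v :: "real ^ 'n" by (simp add: coords_def)
  then show ?thesis
    using bobkov_PiM[OF finite_class.finite_UNIV s f] smooth_imp_continuous(1)[OF s, of UNIV] cont
    unfolding std_gaussian_eq_distr
    by (subst (1 2) integral_distr) (auto intro: borel_measurable_continuous_onI)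
qed

section \<open>Regularised norm of the projection onto a cone\<close>

text \<open>The derivative is bounded by 1 because \<open>\<bar>z\<bar> \<le> 1 + z\<^sup>2 / 2
  \<le> exp (z\<^sup>2 / 2)\<close>.\<close>

lemma std_normal_density_lipschitz: "\<bar>std_normal_density x - std_normal_density y\<bar> \<le> \<bar>x - y\<bar>"
proof -
  have d: "\<bar>- z * std_normal_density z\<bar> \<le> 1" for z :: real
  proof -
    have "\<bar>z\<bar> \<le> 1 + z\<^sup>2 / 2"
      using zero_le_power2[of "\<bar>z\<bar> - 1"] by (simp add: power2_diff)
    also have "\<dots> \<le> exp (z\<^sup>2 / 2)" by (rule exp_ge_add_one_self)
    finally have "\<bar>z\<bar> * exp (- z\<^sup>2 / 2) \<le> 1"
      by (simp add: exp_minus field_simps)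
    moreover have "std_normal_density z \<le> exp (- z\<^sup>2 / 2)"
    proof -
      have "sqrt (2 * pi) \<ge> sqrt 1" using pi_gt3 by (intro real_sqrt_le_mono) auto
      then show ?thesis by (simp add: std_normal_density_def field_simps)
    qed
    ultimately show ?thesis
      by (simp add: abs_mult) (meson abs_ge_zero mult_left_mono order_trans)
  qed
  have "norm (std_normal_density x - std_normal_density y) \<le> 1 * norm (x - y)"
    by (rule field_differentiable_bound[where S = UNIV and f' = "\<lambda>z. - z * std_normal_density z"])
       (use d has_real_derivative_std_normal_density in \<open>auto simp del: mult_minus_left\<close>)
  then show ?thesis by simp
qed

text \<open>Mean value theorem plus the Lipschitz bound for the density. Being uniform in
  \<open>a\<close>, the error can be integrated, which replaces differentiation under the integral
  sign.\<close>

lemma Phi_quadratic_error: "\<bar>Phi b - Phi a - std_normal_density a * (b - a)\<bar> \<le> (b - a)\<^sup>2"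
proof -
  have main: "\<exists>z. \<bar>z - c\<bar> \<le> \<bar>b - a\<bar> \<and> Phi b - Phi a = (b - a) * std_normal_density z"
    if "c = a \<or> c = b" "a < b" for a b c
  proof -
    obtain z where "a < z" "z < b" "Phi b - Phi a = (b - a) * std_normal_density z"
      using MVT2[OF \<open>a < b\<close>, of Phi std_normal_density] has_real_derivative_Phi by blast
    then show ?thesis using that by (intro exI[of _ z]) auto
  qed
  have "\<exists>z. \<bar>z - a\<bar> \<le> \<bar>b - a\<bar> \<and> Phi b - Phi a = (b - a) * std_normal_density z"
  proof (cases a b rule: linorder_cases)
    case less
    then show ?thesis using main[where a = a and b = b and c = a] by blast
  next
    case greater
    then obtain z where "\<bar>z - a\<bar> \<le> \<bar>a - b\<bar>" "Phi a - Phi b = (a - b) * std_normal_density z"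
      using main[where a = b and b = a and c = a] by blast
    then show ?thesis by (intro exI[of _ z]) (auto simp: algebra_simps)
  qed (auto intro: exI[of _ a])
  then obtain z where z: "\<bar>z - a\<bar> \<le> \<bar>b - a\<bar>" "Phi b - Phi a = (b - a) * std_normal_density z"
    by blast
  have "\<bar>Phi b - Phi a - std_normal_density a * (b - a)\<bar> = \<bar>b - a\<bar> * \<bar>std_normal_density z - std_normal_density a\<bar>"
    by (simp add: z(2) algebra_simps flip: abs_mult)
  also have "\<dots> \<le> \<bar>b - a\<bar> * \<bar>b - a\<bar>"
    using std_normal_density_lipschitz[of z a] z(1) by (intro mult_left_mono) auto
  finally show ?thesis by (simp add: power2_eq_square)
qed

section \<open>The projection onto a closed convex cone\<close>

context
  fixes K :: "'a::euclidean_space set"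
  assumes K: "K \<in> closed_convex_cones"
begin

lemma ccc_closed: "closed K" and ccc_convex: "convex K" and ccc_cone: "cone K" and ccc_nonempty: "K \<noteq> {}"
  using K by (auto simp: closed_convex_cones_def)

lemma ccc_zero: "0 \<in> K"
  using cone_contains_0[OF ccc_cone] ccc_nonempty by blast

lemma proj_in_cone: "closest_point K x \<in> K"
  by (rule closest_point_in_set[OF ccc_closed ccc_nonempty])

text \<open>The variational inequality of the projection is tested at twice the projection and at 0;
  both lie in the cone, and together they force orthogonality of the residual.\<close>

lemma inner_proj: "x \<bullet> closest_point K x = (norm (closest_point K x))\<^sup>2"
proof -
  have "2 *\<^sub>R closest_point K x \<in> K"
    using proj_in_cone ccc_cone by (simp add: cone_def)
  then have "(x - closest_point K x) \<bullet> (2 *\<^sub>R closest_point K x - closest_point K x) \<le> 0"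
    by (rule closest_point_dot[OF ccc_convex ccc_closed])
  moreover have "(x - closest_point K x) \<bullet> (0 - closest_point K x) \<le> 0"
    by (rule closest_point_dot[OF ccc_convex ccc_closed ccc_zero])
  ultimately show ?thesis
    by (simp add: algebra_simps power2_norm_eq_inner scaleR_2)
qed

text \<open>Equality holds at \<open>u = closest_point K x\<close>, by \<open>inner_proj\<close>.
  The squared projection norm is thus a supremum of affine functions of \<open>x\<close>, hence
  convex.\<close>

lemma norm_proj_sq_ge:
  assumes "u \<in> K"
  shows "2 * (u \<bullet> x) - (norm u)\<^sup>2 \<le> (norm (closest_point K x))\<^sup>2"
proof -
  have "dist x (closest_point K x) \<le> dist x u"
    by (rule closest_point_le[OF ccc_closed assms])
  then have "(norm (x - closest_point K x))\<^sup>2 \<le> (norm (x - u))\<^sup>2"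
    by (simp add: dist_norm power_mono)
  then show ?thesis
    using inner_proj[of x]
    by (simp add: power2_norm_eq_inner inner_diff_left inner_diff_right inner_commute)
qed

lemma proj_lipschitz: "norm (closest_point K x - closest_point K y) \<le> norm (x - y)"
  using closest_point_lipschitz[OF ccc_convex ccc_closed ccc_nonempty, of x y] by (simp add: dist_norm)

text \<open>The squared norm has gradient \<open>2 *\<^sub>R closest_point K x\<close>. Each bound
  inserts the projection at one of the two points as a competitor at the other; the upper one also
  uses that the projection is 1-Lipschitz.\<close>

lemma norm_proj_sq_diff:
  "0 \<le> (norm (closest_point K (x + h)))\<^sup>2 - (norm (closest_point K x))\<^sup>2 - 2 * (closest_point K x \<bullet> h)"
  "(norm (closest_point K (x + h)))\<^sup>2 - (norm (closest_point K x))\<^sup>2 - 2 * (closest_point K x \<bullet> h) \<le> 2 * (norm h)\<^sup>2"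
proof -
  define a b where "a = closest_point K x" and "b = closest_point K (x + h)"
  have ab: "a \<bullet> x = (norm a)\<^sup>2" "b \<bullet> (x + h) = (norm b)\<^sup>2"
    using inner_proj[of x] inner_proj[of "x + h"] by (simp_all add: a_def b_def inner_commute)
  have "2 * (a \<bullet> (x + h)) - (norm a)\<^sup>2 \<le> (norm b)\<^sup>2" "2 * (b \<bullet> x) - (norm b)\<^sup>2 \<le> (norm a)\<^sup>2"
    unfolding a_def b_def by (rule norm_proj_sq_ge[OF proj_in_cone])+
  moreover have "(b - a) \<bullet> h \<le> norm h * norm h"
    using norm_cauchy_schwarz[of "b - a" h] proj_lipschitz[of "x + h" x]
      mult_right_mono[of "norm (b - a)" "norm h" "norm h"]
    by (simp add: a_def b_def)
  ultimately show "0 \<le> (norm (closest_point K (x + h)))\<^sup>2 - (norm (closest_point K x))\<^sup>2 - 2 * (closest_point K x \<bullet> h)"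
    "(norm (closest_point K (x + h)))\<^sup>2 - (norm (closest_point K x))\<^sup>2 - 2 * (closest_point K x \<bullet> h) \<le> 2 * (norm h)\<^sup>2"
    using ab by (simp_all add: a_def[symmetric] b_def[symmetric] inner_add_right inner_diff_left power2_eq_square[of "norm h"])
qed

text \<open>The norm of the pair \<open>(s, closest_point K x)\<close>: still 1-Lipschitz, but
  bounded away from 0, where the projection norm may have a kink.\<close>

definition reg_norm :: "real \<Rightarrow> 'a \<Rightarrow> real" where
  "reg_norm s x = sqrt (s\<^sup>2 + (norm (closest_point K x))\<^sup>2)"

lemma reg_norm_bounds:
  assumes "0 < s"
  shows "s \<le> reg_norm s x" "norm (closest_point K x) \<le> reg_norm s x"
    "reg_norm s x \<le> norm (closest_point K x) + s"
  using assms unfolding reg_norm_def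
  by (auto intro!: real_le_rsqrt order_trans[OF sqrt_sum_squares_le_sum_abs])

lemma reg_norm_lipschitz: "\<bar>reg_norm s x - reg_norm s y\<bar> \<le> norm (x - y)"
proof -
  have "reg_norm s z = norm (s, closest_point K z)" for z by (simp add: reg_norm_def norm_Pair)
  then have "\<bar>reg_norm s x - reg_norm s y\<bar> \<le> norm ((s, closest_point K x) - (s, closest_point K y))"
    using norm_triangle_ineq3 by metis
  also have "\<dots> \<le> norm (x - y)" using proj_lipschitz by simp
  finally show ?thesis .
qed

text \<open>The expansion of the squared norm is transferred to its root by \<open>r2\<^sup>2 -
  r1\<^sup>2 = (r2 - r1)\<^sup>2 + 2 * r1 * (r2 - r1)\<close>. The error
  \<open>(e - (r2 - r1)\<^sup>2) / (2 * r1)\<close> is a difference of two nonnegative quantities of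
  order \<open>(norm h)\<^sup>2\<close>, divided by at least \<open>2 * s\<close>.\<close>

lemma reg_norm_quadratic_error:
  assumes "0 < s"
  shows "\<bar>reg_norm s (x + h) - reg_norm s x - (closest_point K x \<bullet> h) / reg_norm s x\<bar> \<le> 2 * (norm h)\<^sup>2 / s"
proof -
  define r1 r2 e where "r1 = reg_norm s x" and "r2 = reg_norm s (x + h)"
    and "e = (norm (closest_point K (x + h)))\<^sup>2 - (norm (closest_point K x))\<^sup>2 - 2 * (closest_point K x \<bullet> h)"
  have r: "s \<le> r1" "0 < r1" using reg_norm_bounds(1)[OF assms, of x] assms by (auto simp: r1_def)
  have e: "0 \<le> e" "e \<le> 2 * (norm h)\<^sup>2"
    using norm_proj_sq_diff by (auto simp: e_def)
  have "r2\<^sup>2 - r1\<^sup>2 = e + 2 * (closest_point K x \<bullet> h)"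
    by (simp add: r1_def r2_def reg_norm_def e_def)
  moreover have "r2\<^sup>2 - r1\<^sup>2 = (r2 - r1)\<^sup>2 + 2 * r1 * (r2 - r1)" by (simp add: power2_eq_square algebra_simps)
  ultimately have "r2 - r1 = (e - (r2 - r1)\<^sup>2 + 2 * (closest_point K x \<bullet> h)) / (2 * r1)"
    using r by (subst eq_divide_eq) (simp add: algebra_simps)
  then have eq: "r2 - r1 - (closest_point K x \<bullet> h) / r1 = (e - (r2 - r1)\<^sup>2) / (2 * r1)"
    using r by (simp add: add_divide_distrib)
  have "\<bar>r2 - r1\<bar> \<le> norm h" using reg_norm_lipschitz[of s "x + h" x] by (simp add: r1_def r2_def)
  then have "(r2 - r1)\<^sup>2 \<le> (norm h)\<^sup>2" by (simp add: abs_le_square_iff[symmetric])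
  then have "\<bar>e - (r2 - r1)\<^sup>2\<bar> \<le> 2 * (norm h)\<^sup>2" using e zero_le_power2[of "r2 - r1"] by linarith
  then have "\<bar>(e - (r2 - r1)\<^sup>2) / (2 * r1)\<bar> \<le> 2 * (norm h)\<^sup>2 / (2 * s)"
    unfolding abs_divide using r assms by (intro frac_le) auto
  also have "\<dots> \<le> 2 * (norm h)\<^sup>2 / s" using assms by (simp add: field_simps)
  finally show ?thesis unfolding eq[symmetric] by (simp add: r1_def r2_def)
qed

lemma unit_field_lipschitz:
  assumes "0 < s"
  shows "norm (closest_point K x /\<^sub>R reg_norm s x - closest_point K y /\<^sub>R reg_norm s y) \<le> 2 * norm (x - y) / s"
proof -
  define r1 r2 p1 p2 where "r1 = reg_norm s x" and "r2 = reg_norm s y"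
    and "p1 = closest_point K x" and "p2 = closest_point K y"
  have r: "s \<le> r1" "s \<le> r2" "norm p2 \<le> r2" "0 < r1" "0 < r2"
    using reg_norm_bounds[OF assms, of x] reg_norm_bounds[OF assms, of y] assms
    by (auto simp: r1_def r2_def p2_def)
  have "p1 /\<^sub>R r1 - p2 /\<^sub>R r2 = (p1 - p2) /\<^sub>R r1 + ((r2 - r1) / (r1 * r2)) *\<^sub>R p2"
  proof -
    have "(r2 - r1) / (r1 * r2) = inverse r1 - inverse r2" using r by (simp add: field_simps)
    then show ?thesis by (simp only:) (simp add: algebra_simps)
  qed
  also have "norm \<dots> \<le> norm ((p1 - p2) /\<^sub>R r1) + norm (((r2 - r1) / (r1 * r2)) *\<^sub>R p2)"
    by (rule norm_triangle_ineq)
  also have "\<dots> = norm (p1 - p2) / r1 + \<bar>r2 - r1\<bar> * (norm p2 / r2) / r1"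
    using r by (simp only: norm_scaleR) (simp add: abs_mult field_simps)
  also have "\<dots> \<le> norm (x - y) / s + norm (x - y) * 1 / s"
    using r assms proj_lipschitz[of x y] reg_norm_lipschitz[of s y x]
    by (intro add_mono frac_le mult_mono) (auto simp: p1_def p2_def r1_def r2_def norm_minus_commute)
  finally show ?thesis by (simp add: r1_def r2_def p1_def p2_def)
qed

text \<open>A single constant must serve all three conditions: \<open>3 / s\<^sup>2\<close> covers
  the quadratic error and the Lipschitz bound, each a sum of \<open>1 / s\<^sup>2\<close> and
  \<open>2 / s\<^sup>2\<close>, and \<open>1 / s\<close> covers the size of the gradient.\<close>

lemma smooth_Phi_reg_norm:
  assumes "0 < s"
  shows "smooth (3 / s\<^sup>2 + 1 / s) (\<lambda>x. Phi ((t - reg_norm s x) / s))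
    (\<lambda>x. (- std_normal_density ((t - reg_norm s x) / s) / s) *\<^sub>R (closest_point K x /\<^sub>R reg_norm s x))"
  unfolding smooth_def
proof (intro conjI allI)
  define a where "a x = (t - reg_norm s x) / s" for x
  define E where "E x = closest_point K x /\<^sub>R reg_norm s x" for x
  have E: "norm (E x) \<le> 1" for x
    using reg_norm_bounds[OF assms, of x] assms by (auto simp: E_def field_simps)
  have al: "\<bar>a x - a y\<bar> \<le> norm (x - y) / s" for x y
  proof -
    have "a x - a y = (reg_norm s y - reg_norm s x) / s" by (simp add: a_def diff_divide_distrib)
    then show ?thesis
      using reg_norm_lipschitz[of s y x] assms by (simp add: divide_right_mono norm_minus_commute)
  qed
  fix x y h
  have "\<bar>Phi (a (x + h)) - Phi (a x) - ((- std_normal_density (a x) / s) *\<^sub>R E x) \<bullet> h\<bar>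
    = \<bar>(Phi (a (x + h)) - Phi (a x) - std_normal_density (a x) * (a (x + h) - a x))
       - std_normal_density (a x) / s * (reg_norm s (x + h) - reg_norm s x - (closest_point K x \<bullet> h) / reg_norm s x)\<bar>"
    using assms by (intro arg_cong[where f = abs]) (simp add: a_def E_def field_simps)
  also have "\<dots> \<le> (a (x + h) - a x)\<^sup>2 + std_normal_density (a x) / s * (2 * (norm h)\<^sup>2 / s)"
  proof (rule order_trans[OF abs_triangle_ineq4], rule add_mono[OF Phi_quadratic_error])
    show "\<bar>std_normal_density (a x) / s * (reg_norm s (x + h) - reg_norm s x - closest_point K x \<bullet> h / reg_norm s x)\<bar>
        \<le> std_normal_density (a x) / s * (2 * (norm h)\<^sup>2 / s)"
      unfolding abs_mult[of "std_normal_density (a x) / s"]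
      by (rule mult_mono[OF _ reg_norm_quadratic_error[OF assms]]) (use assms in auto)
  qed
  also have "\<dots> \<le> (norm h / s)\<^sup>2 + 1 / s * (2 * (norm h)\<^sup>2 / s)"
    using al[of "x + h" x] assms std_normal_density_le_1
    by (intro add_mono mult_right_mono divide_right_mono) (auto simp: abs_le_square_iff[symmetric])
  also have "\<dots> = 3 / s\<^sup>2 * (norm h)\<^sup>2"
    using assms by (simp add: field_simps power2_eq_square)
  also have "\<dots> \<le> (3 / s\<^sup>2 + 1 / s) * (norm h)\<^sup>2"
    using assms by (intro mult_right_mono) auto
  finally show "\<bar>Phi ((t - reg_norm s (x + h)) / s) - Phi ((t - reg_norm s x) / s) -
      ((- std_normal_density ((t - reg_norm s x) / s) / s) *\<^sub>R (closest_point K x /\<^sub>R reg_norm s x)) \<bullet> h\<bar>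
      \<le> (3 / s\<^sup>2 + 1 / s) * (norm h)\<^sup>2"
    by (simp add: a_def E_def)
  have "(- std_normal_density (a x) / s) *\<^sub>R E x - (- std_normal_density (a y) / s) *\<^sub>R E y
    = (1 / s) *\<^sub>R ((std_normal_density (a y) - std_normal_density (a x)) *\<^sub>R E x - std_normal_density (a y) *\<^sub>R (E x - E y))"
    using assms by (simp add: algebra_simps diff_divide_distrib)
  also have "norm \<dots> \<le> 1 / s * (norm ((std_normal_density (a y) - std_normal_density (a x)) *\<^sub>R E x) +
      norm (std_normal_density (a y) *\<^sub>R (E x - E y)))"
    using assms norm_triangle_ineq4[of "(std_normal_density (a y) - std_normal_density (a x)) *\<^sub>R E x"
        "std_normal_density (a y) *\<^sub>R (E x - E y)"]
    by (simp add: divide_right_mono)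
  also have "\<dots> \<le> 1 / s * (norm (x - y) / s * 1 + 1 * (2 * norm (x - y) / s))"
  proof (intro mult_left_mono add_mono)
    have "\<bar>std_normal_density (a y) - std_normal_density (a x)\<bar> \<le> norm (x - y) / s"
      using std_normal_density_lipschitz[of "a y" "a x"] al[of y x] by (simp add: norm_minus_commute)
    then show "norm ((std_normal_density (a y) - std_normal_density (a x)) *\<^sub>R E x) \<le> norm (x - y) / s * 1"
      unfolding norm_scaleR real_norm_def using assms by (intro mult_mono E) auto
    have "norm (E x - E y) \<le> 2 * norm (x - y) / s"
      unfolding E_def by (rule unit_field_lipschitz[OF assms])
    then show "norm (std_normal_density (a y) *\<^sub>R (E x - E y)) \<le> 1 * (2 * norm (x - y) / s)"
      unfolding norm_scaleR by (intro mult_mono) (auto simp: std_normal_density_le_1)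
  qed (use assms in auto)
  also have "\<dots> = 3 / s\<^sup>2 * norm (x - y)"
    using assms by (simp add: field_simps power2_eq_square)
  also have "\<dots> \<le> (3 / s\<^sup>2 + 1 / s) * norm (x - y)"
    using assms by (intro mult_right_mono) auto
  finally show "norm ((- std_normal_density ((t - reg_norm s x) / s) / s) *\<^sub>R (closest_point K x /\<^sub>R reg_norm s x) -
      (- std_normal_density ((t - reg_norm s y) / s) / s) *\<^sub>R (closest_point K y /\<^sub>R reg_norm s y))
      \<le> (3 / s\<^sup>2 + 1 / s) * norm (x - y)"
    by (simp add: a_def E_def)
  have "norm ((- std_normal_density (a x) / s) *\<^sub>R E x) = std_normal_density (a x) * norm (E x) / s"
    using assms by simp
  also have "\<dots> \<le> 1 * 1 / s"
    using assms E std_normal_density_le_1 by (intro divide_right_mono mult_mono) auto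
  also have "\<dots> \<le> 3 / s\<^sup>2 + 1 / s" using assms by simp
  finally show "norm ((- std_normal_density ((t - reg_norm s x) / s) / s) *\<^sub>R (closest_point K x /\<^sub>R reg_norm s x))
      \<le> 3 / s\<^sup>2 + 1 / s" by (simp add: a_def E_def)
qed

lemma continuous_on_proj: "continuous_on A (closest_point K)"
  by (rule continuous_on_closest_point[OF ccc_convex ccc_closed ccc_nonempty])

lemma borel_measurable_proj [measurable]: "closest_point K \<in> borel_measurable borel"
  by (rule borel_measurable_continuous_onI[OF continuous_on_proj])

lemma borel_measurable_reg_norm [measurable]: "reg_norm s \<in> borel_measurable borel"
  unfolding reg_norm_def by measurable


end

section \<open>Isoperimetry for the norm of the projection\<close>

text \<open>\<open>A\<close> is the distribution function of the regularised norm plus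
  \<open>s\<close> times an independent standard normal variable. Bobkov's inequality bounds
  \<open>profile (A t)\<close> by \<open>sqrt (1 + s\<^sup>2)\<close> times the derivative of
  \<open>A\<close>, and \<open>quantile\<close> has derivative \<open>1 / profile\<close>.\<close>

lemma quantile_reg_cdf_increment:
  fixes K :: "(real ^ 'n::finite) set"
  assumes K: "K \<in> closed_convex_cones" and s: "0 < s" and t: "t1 \<le> t2"
  defines "A \<equiv> \<lambda>t. \<integral>x. Phi ((t - reg_norm K s x) / s) \<partial>std_gaussian"
  shows "(t2 - t1) / sqrt (1 + s\<^sup>2) \<le> quantile (A t2) - quantile (A t1)"
proof -
  interpret G: prob_space "std_gaussian :: (real ^ 'n) measure" by (rule prob_space_std_gaussian)
  have [measurable]: "reg_norm K s \<in> borel_measurable borel" by (rule borel_measurable_reg_norm[OF K])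
  have [measurable]: "Phi \<in> borel_measurable borel"
    by (rule borel_measurable_continuous_onI) (simp add: continuous_at_imp_continuous_on isCont_Phi)
  define B where "B t = (\<integral>x. std_normal_density ((t - reg_norm K s x) / s) / s \<partial>std_gaussian)" for t
  have iA: "integrable std_gaussian (\<lambda>x. Phi ((t - reg_norm K s x) / s))" for t
    by (rule G.integrable_const_bound[where B = 1])
       (auto simp: Phi_bounds less_imp_le abs_of_pos intro!: measurable_compose[OF _ \<open>Phi \<in> borel_measurable borel\<close>])
  have iB': "integrable std_gaussian (\<lambda>x. std_normal_density ((t - reg_norm K s x) / s))" for t
    by (rule G.integrable_const_bound[where B = 1]) (auto simp: std_normal_density_le_1)
  have iB: "integrable std_gaussian (\<lambda>x. std_normal_density ((t - reg_norm K s x) / s) / s)" for t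
    using iB'[of t] by simp
  have A01: "0 < A t" "A t < 1" for t
    using expectation_in_unit[OF G.prob_space_axioms, of "\<lambda>x. Phi ((t - reg_norm K s x) / s)"]
      Phi_bounds iA[of t] by (auto simp: A_def)
  have A': "(A has_real_derivative B t) (at t)" for t
  proof -
    have err: "\<bar>A (t + \<delta>) - A t - B t * \<delta>\<bar> \<le> \<delta>\<^sup>2 / s\<^sup>2" for \<delta>
    proof -
      let ?e = "\<lambda>x. Phi ((t + \<delta> - reg_norm K s x) / s) - Phi ((t - reg_norm K s x) / s) - std_normal_density ((t - reg_norm K s x) / s) / s * \<delta>"
      have "A (t + \<delta>) - A t - B t * \<delta> = (\<integral>x. ?e x \<partial>std_gaussian)"
        using iA[of t] iA[of "t + \<delta>"] iB'[of t] by (simp add: A_def B_def)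
      then have "\<bar>A (t + \<delta>) - A t - B t * \<delta>\<bar> = \<bar>\<integral>x. ?e x \<partial>std_gaussian\<bar>"
        by (simp only:)
      also have "\<dots> \<le> (\<integral>x. \<bar>?e x\<bar> \<partial>std_gaussian)"
        by (rule integral_abs_bound)
      also have "\<dots> \<le> (\<integral>x. \<delta>\<^sup>2 / s\<^sup>2 \<partial>(std_gaussian :: (real ^ 'n) measure))"
      proof (rule integral_mono)
        show "integrable std_gaussian (\<lambda>x. \<bar>?e x\<bar>)"
          using iA[of t] iA[of "t + \<delta>"] iB[of t]
          by (intro integrable_abs Bochner_Integration.integrable_diff integrable_mult_left) auto
        fix x
        have "(t + \<delta> - reg_norm K s x) / s - (t - reg_norm K s x) / s = \<delta> / s"
          by (simp add: diff_divide_distrib add_divide_distrib)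
        then show "\<bar>?e x\<bar> \<le> \<delta>\<^sup>2 / s\<^sup>2"
          using Phi_quadratic_error[of "(t + \<delta> - reg_norm K s x) / s" "(t - reg_norm K s x) / s"]
          by (simp add: power_divide)
      qed simp
      also have "\<dots> = \<delta>\<^sup>2 / s\<^sup>2" using G.prob_space by simp
      finally show ?thesis .
    qed
    have "(\<lambda>\<delta>. (A (t + \<delta>) - A t) / \<delta> - B t) \<midarrow>0\<rightarrow> 0"
    proof (rule Lim_null_comparison)
      show "\<forall>\<^sub>F \<delta> in at 0. norm ((A (t + \<delta>) - A t) / \<delta> - B t) \<le> \<bar>\<delta>\<bar> / s\<^sup>2"
      proof (rule eventually_at_filter[THEN iffD2], rule always_eventually, intro allI impI)
        fix \<delta> :: real assume "\<delta> \<noteq> 0"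
        then have "norm ((A (t + \<delta>) - A t) / \<delta> - B t) = \<bar>A (t + \<delta>) - A t - B t * \<delta>\<bar> / \<bar>\<delta>\<bar>"
          by (simp add: field_simps flip: abs_divide)
        also have "\<dots> \<le> \<delta>\<^sup>2 / s\<^sup>2 / \<bar>\<delta>\<bar>" by (intro divide_right_mono err) auto
        also have "\<delta>\<^sup>2 = \<bar>\<delta>\<bar> * \<bar>\<delta>\<bar>" by (simp add: power2_eq_square)
        also have "\<bar>\<delta>\<bar> * \<bar>\<delta>\<bar> / s\<^sup>2 / \<bar>\<delta>\<bar> = \<bar>\<delta>\<bar> / s\<^sup>2"
          using \<open>\<delta> \<noteq> 0\<close> by (subst divide_divide_eq_left, subst mult_divide_mult_cancel_right) auto
        finally show "norm ((A (t + \<delta>) - A t) / \<delta> - B t) \<le> \<bar>\<delta>\<bar> / s\<^sup>2" .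
      qed
      show "((\<lambda>\<delta>. \<bar>\<delta>\<bar> / s\<^sup>2) \<longlongrightarrow> 0) (at 0)" using s by (auto intro!: tendsto_eq_intros)
    qed
    then show ?thesis by (simp add: DERIV_def LIM_zero_cancel)
  qed
  \<comment> \<open>With \<open>d\<close> the density at the cut-off argument, the two terms under
    the root are \<open>d\<close> and at most \<open>d / s\<close>, and \<open>d\<^sup>2 + (d /
    s)\<^sup>2 = (1 + s\<^sup>2) * (d / s)\<^sup>2\<close>.\<close>
  have prof: "profile (A t) \<le> sqrt (1 + s\<^sup>2) * B t" for t
  proof -
    let ?g = "\<lambda>x. (- std_normal_density ((t - reg_norm K s x) / s) / s) *\<^sub>R (closest_point K x /\<^sub>R reg_norm K s x)"
    have "profile (A t) \<le> (\<integral>x. sqrt ((profile (Phi ((t - reg_norm K s x) / s)))\<^sup>2 + (norm (?g x))\<^sup>2) \<partial>std_gaussian)"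
      unfolding A_def by (rule bobkov[OF smooth_Phi_reg_norm[OF K s]]) (simp add: Phi_bounds)
    also have "\<dots> \<le> (\<integral>x. sqrt (1 + s\<^sup>2) * (std_normal_density ((t - reg_norm K s x) / s) / s) \<partial>std_gaussian)"
    proof (rule integral_mono')
      show "integrable std_gaussian (\<lambda>x. sqrt (1 + s\<^sup>2) * (std_normal_density ((t - reg_norm K s x) / s) / s))"
        by (rule integrable_mult_right[OF iB])
      fix x
      define d where "d = std_normal_density ((t - reg_norm K s x) / s)"
      have d: "0 \<le> d" by (simp add: d_def)
      have "norm (closest_point K x /\<^sub>R reg_norm K s x) \<le> 1"
        using reg_norm_bounds[OF K s, of x] s by (simp add: field_simps)
      then have "d / s * norm (closest_point K x /\<^sub>R reg_norm K s x) \<le> d / s * 1"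
        using s d by (intro mult_left_mono) auto
      moreover have "norm (?g x) = d / s * norm (closest_point K x /\<^sub>R reg_norm K s x)"
        unfolding d_def[symmetric] by (subst norm_scaleR) (use s d in simp)
      ultimately have "norm (?g x) \<le> d / s" by simp
      then have "sqrt ((profile (Phi ((t - reg_norm K s x) / s)))\<^sup>2 + (norm (?g x))\<^sup>2) \<le> sqrt (d\<^sup>2 + (d / s)\<^sup>2)"
        unfolding profile_Phi d_def[symmetric] by (intro sqrt_sq_add_sq_mono d) auto
      also have "d\<^sup>2 + (d / s)\<^sup>2 = (1 + s\<^sup>2) * (d / s)\<^sup>2"
        using s by (simp add: field_simps power2_eq_square)
      also have "sqrt \<dots> = sqrt (1 + s\<^sup>2) * (d / s)"
        using s d by (simp add: real_sqrt_mult)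
      finally show "sqrt ((profile (Phi ((t - reg_norm K s x) / s)))\<^sup>2 + (norm (?g x))\<^sup>2)
          \<le> sqrt (1 + s\<^sup>2) * (std_normal_density ((t - reg_norm K s x) / s) / s)" by (simp add: d_def)
    qed (use s in auto)
    also have "\<dots> = sqrt (1 + s\<^sup>2) * B t" by (simp add: B_def)
    finally show ?thesis .
  qed
  have "quantile (A t1) - t1 / sqrt (1 + s\<^sup>2) \<le> quantile (A t2) - t2 / sqrt (1 + s\<^sup>2)"
  proof (rule DERIV_nonneg_imp_nondecreasing[OF t])
    fix t
    have pos: "0 < sqrt (1 + s\<^sup>2)" by (simp add: add_pos_nonneg)
    have "((\<lambda>t. quantile (A t) - t / sqrt (1 + s\<^sup>2)) has_real_derivative
        1 / profile (A t) * B t - 1 / sqrt (1 + s\<^sup>2)) (at t)"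
      using DERIV_chain2[OF has_real_derivative_quantile[OF A01] A'] DERIV_cdivide[OF DERIV_ident]
      by (intro DERIV_diff)
    moreover have "0 \<le> 1 / profile (A t) * B t - 1 / sqrt (1 + s\<^sup>2)"
      using prof[of t] profile_pos[of "A t"] pos by (simp add: field_simps)
    ultimately show "\<exists>y. ((\<lambda>t. quantile (A t) - t / sqrt (1 + s\<^sup>2)) has_real_derivative y) (at t) \<and> 0 \<le> y"
      by blast
  qed
  then show ?thesis by (simp add: diff_divide_distrib)
qed

text \<open>The regularisation at level \<open>s = e\<^sup>2\<close> is evaluated at \<open>t + e\<close>: since \<open>s\<close> is much smaller than \<open>e\<close>,
  the limit is the distribution function itself rather than its mean with the left limit.\<close>

lemma reg_cdf_tendsto:
  fixes K :: "(real ^ 'n::finite) set"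
  assumes K: "K \<in> closed_convex_cones"
  defines "e \<equiv> \<lambda>k. 1 / real (Suc k)"
  shows "(\<lambda>k. \<integral>x. Phi ((t + e k - reg_norm K ((e k)\<^sup>2) x) / (e k)\<^sup>2) \<partial>std_gaussian)
    \<longlonglongrightarrow> measure std_gaussian {x. norm (closest_point K x) \<le> t}"
proof -
  interpret G: prob_space "std_gaussian :: (real ^ 'n) measure" by (rule prob_space_std_gaussian)
  have [measurable]: "reg_norm K s \<in> borel_measurable borel" for s by (rule borel_measurable_reg_norm[OF K])
  have [measurable]: "closest_point K \<in> borel_measurable borel" by (rule borel_measurable_proj[OF K])
  have [measurable]: "Phi \<in> borel_measurable borel"
    by (rule borel_measurable_continuous_onI) (simp add: continuous_at_imp_continuous_on isCont_Phi)
  have e: "0 < e k" "0 < (e k)\<^sup>2" for k by (simp_all add: e_def)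
  let ?S = "{x :: real ^ 'n. norm (closest_point K x) \<le> t}"
  have "(\<lambda>k. \<integral>x. Phi ((t + e k - reg_norm K ((e k)\<^sup>2) x) / (e k)\<^sup>2) \<partial>std_gaussian)
    \<longlonglongrightarrow> (\<integral>x. indicator ?S x \<partial>(std_gaussian :: (real ^ 'n) measure))"
  proof (rule integral_dominated_convergence[where w = "\<lambda>_. 1"])
    show "AE x in std_gaussian. (\<lambda>k. Phi ((t + e k - reg_norm K ((e k)\<^sup>2) x) / (e k)\<^sup>2)) \<longlonglongrightarrow> indicator ?S x"
    proof (rule AE_I2)
      fix x
      define r where "r = norm (closest_point K x)"
      have rn: "r \<le> reg_norm K ((e k)\<^sup>2) x" "reg_norm K ((e k)\<^sup>2) x \<le> r + (e k)\<^sup>2" for k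
        using reg_norm_bounds[OF K e(2)] by (auto simp: r_def)
      have lim: "filterlim (\<lambda>k. real (Suc k)) at_top sequentially"
        by (rule filterlim_compose[OF filterlim_real_sequentially filterlim_Suc])
      show "(\<lambda>k. Phi ((t + e k - reg_norm K ((e k)\<^sup>2) x) / (e k)\<^sup>2)) \<longlonglongrightarrow> indicator ?S x"
      proof (cases "r \<le> t")
        case True
        \<comment> \<open>From \<open>e k * (k + 1) = 1\<close> follows
          \<open>(e k - (e k)\<^sup>2) / (e k)\<^sup>2 = k\<close>: the shift \<open>e k\<close>
          outweighs the regularisation error even when \<open>r = t\<close>.\<close>
        have "real k \<le> (t + e k - reg_norm K ((e k)\<^sup>2) x) / (e k)\<^sup>2" for k
        proof -
          have "e k * (real k + 1) = 1" by (simp add: e_def)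
          then have "e k * real k = 1 - e k" by (simp add: algebra_simps)
          then have "e k * (e k * real k) = e k * (1 - e k)" by (simp only:)
          then have "real k * (e k)\<^sup>2 = e k - (e k)\<^sup>2"
            by (simp add: power2_eq_square algebra_simps)
          then show ?thesis using rn(2)[of k] True e(2)[of k] by (simp add: le_divide_eq)
        qed
        then have "filterlim (\<lambda>k. (t + e k - reg_norm K ((e k)\<^sup>2) x) / (e k)\<^sup>2) at_top sequentially"
          by (intro filterlim_at_top_mono[OF filterlim_real_sequentially] always_eventually allI)
        from filterlim_compose[OF Phi_at_top this] True show ?thesis by (simp add: r_def)
      next
        case False
        \<comment> \<open>The right side is \<open>(t - r + e k) / (e k)\<^sup>2\<close> written in
          powers of \<open>Suc k\<close>; it tends to minus infinity because \<open>r - t\<close> is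
          a fixed positive number.\<close>
        have "(t + e k - reg_norm K ((e k)\<^sup>2) x) / (e k)\<^sup>2 \<le> - ((r - t) * real (Suc k) - 1) * real (Suc k)" for k
        proof -
          have "- ((r - t) * real (Suc k) - 1) * real (Suc k) * (e k)\<^sup>2 = t - r + e k"
            by (simp add: e_def power2_eq_square field_simps del: of_nat_Suc)
          then show ?thesis using rn(1)[of k] e(2)[of k] by (simp add: divide_le_eq del: of_nat_Suc)
        qed
        moreover have "filterlim (\<lambda>k. - (((r - t) * real (Suc k) - 1) * real (Suc k))) at_bot sequentially"
        proof -
          have "filterlim (\<lambda>k. -1 + (r - t) * real (Suc k)) at_top sequentially"
            using False by (intro filterlim_tendsto_add_at_top[OF tendsto_const]
                filterlim_tendsto_pos_mult_at_top[OF tendsto_const] lim) auto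
          from filterlim_at_top_mult_at_top[OF this lim] show ?thesis
            by (simp add: filterlim_uminus_at_top algebra_simps del: of_nat_Suc)
        qed
        ultimately have "filterlim (\<lambda>k. (t + e k - reg_norm K ((e k)\<^sup>2) x) / (e k)\<^sup>2) at_bot sequentially"
          unfolding filterlim_uminus_at_bot
          by (elim filterlim_at_top_mono) (auto intro!: always_eventually simp: le_minus_iff algebra_simps)
        from filterlim_compose[OF Phi_at_bot this] False show ?thesis by (simp add: r_def)
      qed
    qed
    show "AE x in std_gaussian. norm (Phi ((t + e k - reg_norm K ((e k)\<^sup>2) x) / (e k)\<^sup>2)) \<le> 1" for k
      by (auto simp: Phi_bounds less_imp_le abs_of_pos)
  qed (auto intro!: measurable_compose[OF _ \<open>Phi \<in> borel_measurable borel\<close>])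
  then show ?thesis by simp
qed

text \<open>Stated through \<open>Phi\<close> so that \<open>quantile\<close> is evaluated only at
  \<open>F t1\<close>, where it is continuous. The shift \<open>e k\<close> is the same at both
  times and cancels in the increment.\<close>

theorem proj_norm_cdf_isoperimetry:
  fixes K :: "(real ^ 'n::finite) set"
  assumes K: "K \<in> closed_convex_cones" and t: "t1 \<le> t2"
  defines "F \<equiv> \<lambda>t. measure std_gaussian {x. norm (closest_point K x) \<le> t}"
  assumes F: "0 < F t1" "F t1 < 1"
  shows "Phi (quantile (F t1) + (t2 - t1)) \<le> F t2"
proof -
  define e where "e k = 1 / real (Suc k)" for k
  define A where "A k t = (\<integral>x. Phi ((t + e k - reg_norm K ((e k)\<^sup>2) x) / (e k)\<^sup>2) \<partial>std_gaussian)" for k t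
  have e0: "e \<longlonglongrightarrow> 0"
    unfolding e_def[abs_def] using LIMSEQ_inverse_real_of_nat by (simp add: inverse_eq_divide)
  have lim: "(\<lambda>k. A k t) \<longlonglongrightarrow> F t" for t
    unfolding A_def F_def e_def by (rule reg_cdf_tendsto[OF K])
  have A01: "0 < A k t" "A k t < 1" for k t
  proof -
    have [measurable]: "reg_norm K s \<in> borel_measurable borel" for s by (rule borel_measurable_reg_norm[OF K])
    have [measurable]: "Phi \<in> borel_measurable borel"
      by (rule borel_measurable_continuous_onI) (simp add: continuous_at_imp_continuous_on isCont_Phi)
    show "0 < A k t" "A k t < 1"
      using expectation_in_unit[OF prob_space_std_gaussian, of "\<lambda>x. Phi ((t + e k - reg_norm K ((e k)\<^sup>2) x) / (e k)\<^sup>2)"]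
      by (auto simp: A_def Phi_bounds)
  qed
  have "(\<lambda>k. (t2 - t1) / sqrt (1 + ((e k)\<^sup>2)\<^sup>2)) \<longlonglongrightarrow> (t2 - t1) / sqrt (1 + (0\<^sup>2)\<^sup>2)"
    by (intro tendsto_intros e0) auto
  then have "(\<lambda>k. Phi (quantile (A k t1) + (t2 - t1) / sqrt (1 + ((e k)\<^sup>2)\<^sup>2)))
      \<longlonglongrightarrow> Phi (quantile (F t1) + (t2 - t1))"
    by (intro isCont_tendsto_compose[OF isCont_Phi] tendsto_add
        isCont_tendsto_compose[OF isCont_quantile[OF F]] lim) simp
  moreover have "Phi (quantile (A k t1) + (t2 - t1) / sqrt (1 + ((e k)\<^sup>2)\<^sup>2)) \<le> A k t2" for k
  proof -
    have "0 < (e k)\<^sup>2" by (simp add: e_def)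
    then have "(t2 - t1) / sqrt (1 + ((e k)\<^sup>2)\<^sup>2) \<le> quantile (A k t2) - quantile (A k t1)"
      using quantile_reg_cdf_increment[OF K, of "(e k)\<^sup>2" "t1 + e k" "t2 + e k"] t by (simp add: A_def)
    then have "Phi (quantile (A k t1) + (t2 - t1) / sqrt (1 + ((e k)\<^sup>2)\<^sup>2)) \<le> Phi (quantile (A k t2))"
      by simp
    then show ?thesis using A01 by (simp add: Phi_quantile)
  qed
  ultimately show ?thesis
    using lim[of t2] by (intro LIMSEQ_le) auto
qed

section \<open>Moments of the Gaussian measure\<close>

text \<open>The characteristic function factors over the coordinates, and the variances
  \<open>(u $ i)\<^sup>2\<close> add up to 1.\<close>

lemma distr_std_gaussian_inner:
  fixes u :: "real ^ 'n::finite"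
  assumes "norm u = 1"
  shows "distr std_gaussian borel (\<lambda>x. u \<bullet> x) = std_normal_distribution"
proof (rule Levy_uniqueness)
  have m: "(\<lambda>x. u \<bullet> x) \<in> borel_measurable (std_gaussian :: (real ^ 'n) measure)" by simp
  show "real_distribution (distr std_gaussian borel (\<lambda>x. u \<bullet> x))"
    by (intro real_distribution.intro real_distribution_axioms.intro
        prob_space.prob_space_distr[OF prob_space_std_gaussian m]) auto
  show "real_distribution std_normal_distribution" by (rule real_dist_normal_dist)
  show "char (distr std_gaussian borel (\<lambda>x. u \<bullet> x)) = char std_normal_distribution"
  proof
    fix t
    have "char (distr std_gaussian borel (\<lambda>x. u \<bullet> x)) t = (\<integral>x. iexp (t * (u \<bullet> x)) \<partial>std_gaussian)"
      unfolding char_def by (subst integral_distr) auto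
    also have "\<dots> = (\<integral>w. iexp (t * (u \<bullet> coords UNIV w)) \<partial>Pi\<^sub>M UNIV (\<lambda>_. std_normal_distribution))"
      unfolding std_gaussian_eq_distr by (subst integral_distr) auto
    also have "\<dots> = (\<integral>w. (\<Prod>i\<in>UNIV. iexp ((t * u $ i) * w i)) \<partial>Pi\<^sub>M UNIV (\<lambda>_. std_normal_distribution))"
      by (intro Bochner_Integration.integral_cong refl)
         (simp add: inner_vec_def coords_def sum_distrib_left mult.assoc flip: exp_sum)
    also have "\<dots> = (\<Prod>i\<in>UNIV. char std_normal_distribution (t * u $ i))"
      unfolding char_def
      by (rule std_normal_product.product_integral_prod) (auto intro!: std_normal.integrable_iexp)
    also have "\<dots> = complex_of_real (\<Prod>i\<in>UNIV. exp (- (t * u $ i)\<^sup>2 / 2))"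
      by (simp add: char_std_normal_distribution)
    also have "(\<Prod>i\<in>UNIV. exp (- (t * u $ i)\<^sup>2 / 2)) = exp (- t\<^sup>2 / 2)"
    proof -
      have "(\<Sum>i\<in>UNIV. (u $ i)\<^sup>2) = 1"
        using assms by (simp add: norm_vec_def L2_set_def)
      then have "(\<Sum>i\<in>UNIV. - (t * u $ i)\<^sup>2 / 2) = - t\<^sup>2 / 2"
        by (simp add: power_mult_distrib sum_negf flip: sum_distrib_left sum_divide_distrib)
      then show ?thesis by (simp flip: exp_sum)
    qed
    finally show "char (distr std_gaussian borel (\<lambda>x. u \<bullet> x)) t = char std_normal_distribution t"
      by (simp add: char_std_normal_distribution)
  qed
qed

lemma measure_std_gaussian_halfspace:
  fixes u :: "real ^ 'n::finite"
  assumes "norm u = 1"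
  shows "measure std_gaussian {x. u \<bullet> x \<le> t} = Phi t"
proof -
  have "Phi t = measure (distr std_gaussian borel (\<lambda>x. u \<bullet> x)) {..t}"
    by (simp add: Phi_def cdf_def distr_std_gaussian_inner[OF assms])
  also have "\<dots> = measure std_gaussian {x. u \<bullet> x \<le> t}"
    by (subst measure_distr) (auto intro: arg_cong[where f = "measure _"])
  finally show ?thesis ..
qed

text \<open>For \<open>0 \<le> u \<bullet> x\<close> the competitor
  \<open>(u \<bullet> x) *\<^sub>R u\<close>, the best multiple of \<open>u\<close>, is inserted in
  \<open>norm_proj_sq_ge\<close>.\<close>

lemma norm_proj_ge_inner:
  assumes K: "K \<in> closed_convex_cones" and u: "u \<in> K" "norm u = 1"
  shows "u \<bullet> x \<le> norm (closest_point K x)"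
proof (cases "0 \<le> u \<bullet> x")
  case True
  have "(u \<bullet> x) *\<^sub>R u \<in> K"
    using ccc_cone[OF K] u True by (auto simp: cone_def)
  from norm_proj_sq_ge[OF K this, of x] have "(u \<bullet> x)\<^sup>2 \<le> (norm (closest_point K x))\<^sup>2"
    using u by (simp add: power2_eq_square)
  then show ?thesis by (rule power2_le_imp_le) simp
next
  case False
  then show ?thesis using norm_ge_zero[of "closest_point K x"] by linarith
qed

lemma nontrivial_cone_unit:
  assumes K: "K \<in> closed_convex_cones" "K \<noteq> {0}"
  obtains u where "u \<in> K" "norm u = 1"
proof -
  obtain v where v: "v \<in> K" "v \<noteq> 0"
    using ccc_nonempty[OF K(1)] K(2) by auto
  then have "v /\<^sub>R norm v \<in> K" using ccc_cone[OF K(1)] by (auto simp: cone_def)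
  then show ?thesis using that[of "v /\<^sub>R norm v"] v by simp
qed

lemma ray_closed_convex_cone:
  fixes e :: "'a::euclidean_space"
  assumes "norm e = 1"
  shows "ray e \<in> closed_convex_cones" "ray e \<noteq> {0}"
proof -
  have eq: "ray e = {x. x = (e \<bullet> x) *\<^sub>R e} \<inter> {x. 0 \<le> e \<bullet> x}"
    using assms by (auto simp: ray_def power2_norm_eq_inner[symmetric]) 
  have "closed (ray e)"
    unfolding eq by (intro closed_Int closed_Collect_eq closed_Collect_le continuous_intros)
  moreover have "convex (ray e)"
  proof -
    have "ray e = (\<lambda>c. c *\<^sub>R e) ` {0..}" by (auto simp: ray_def)
    then show ?thesis by (simp only: convex_linear_image[OF bounded_linear.linear[OF bounded_linear_scaleR_left]] convex_real_interval)
  qed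
  moreover have "cone (ray e)" 
    unfolding cone_def
  proof (intro ballI allI impI)
    fix x :: 'a and c :: real
    assume "x \<in> ray e" "0 \<le> c"
    then obtain d where "x = d *\<^sub>R e" "0 \<le> d" by (auto simp: ray_def)
    then have "c *\<^sub>R x = (c * d) *\<^sub>R e" "0 \<le> c * d" using \<open>0 \<le> c\<close> by auto
    then show "c *\<^sub>R x \<in> ray e" unfolding ray_def by blast
  qed
  moreover have "e \<in> ray e" unfolding ray_def by (auto intro!: exI[of _ 1])
  ultimately show "ray e \<in> closed_convex_cones" by (auto simp: closed_convex_cones_def)
  show "ray e \<noteq> {0}"
  proof
    assume "ray e = {0}"
    with \<open>e \<in> ray e\<close> have "e = 0" by blast
    with assms show False by simp
  qed
qed

text \<open>By \<open>inner_proj\<close> the coefficient is 0 or \<open>e \<bullet> x\<close>; being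
  nonnegative and at least \<open>e \<bullet> x\<close>, it is the maximum.\<close>

lemma norm_proj_ray:
  fixes e :: "'a::euclidean_space"
  assumes "norm e = 1"
  shows "norm (closest_point (ray e) x) = max 0 (e \<bullet> x)"
proof -
  note K = ray_closed_convex_cone(1)[OF assms]
  obtain c where c: "closest_point (ray e) x = c *\<^sub>R e" "0 \<le> c"
    using proj_in_cone[OF K, of x] by (auto simp: ray_def)
  have "c * (e \<bullet> x) = c\<^sup>2"
    using inner_proj[OF K, of x] assms c by (simp add: inner_commute)
  then have "c = 0 \<or> c = e \<bullet> x" by (auto simp: power2_eq_square)
  moreover have "e \<in> ray e" unfolding ray_def by (auto intro!: exI[of _ 1])
  then have "e \<bullet> x \<le> c" using norm_proj_ge_inner[OF K _ assms, of x] c assms by simp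
  ultimately show ?thesis using c assms by auto
qed

lemma integrable_std_normal_powr: "0 \<le> q \<Longrightarrow> integrable std_normal_distribution (\<lambda>z. (1 + \<bar>z\<bar>) powr q)"
proof -
  assume q: "0 \<le> q"
  define m where "m = nat \<lceil>q\<rceil>"
  have i: "integrable std_normal_distribution (\<lambda>z. 2 ^ m * (1 + \<bar>z\<bar> ^ m))"
    using integrable_std_normal_moment_abs[of m]
    by (intro integrable_mult_right Bochner_Integration.integrable_add std_normal.integrable_const)
       (subst integrable_density, auto)
  show ?thesis
  proof (rule Bochner_Integration.integrable_bound[OF i])
    show "AE z in std_normal_distribution. norm ((1 + \<bar>z\<bar>) powr q) \<le> norm (2 ^ m * (1 + \<bar>z\<bar> ^ m))"
    proof (rule AE_I2)
      fix z :: real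
      have "(1 + \<bar>z\<bar>) powr q \<le> (1 + \<bar>z\<bar>) powr real m"
        using q by (intro powr_mono) (auto simp: m_def)
      also have "\<dots> = (1 + \<bar>z\<bar>) ^ m" by (simp add: powr_realpow)
      also have "\<dots> \<le> (2 * max 1 \<bar>z\<bar>) ^ m" by (intro power_mono) auto
      also have "\<dots> = 2 ^ m * max 1 \<bar>z\<bar> ^ m" by (simp add: power_mult_distrib)
      also have "max 1 \<bar>z\<bar> ^ m \<le> 1 + \<bar>z\<bar> ^ m" by (auto simp: max_def)
      finally show "norm ((1 + \<bar>z\<bar>) powr q) \<le> norm (2 ^ m * (1 + \<bar>z\<bar> ^ m))" by simp
    qed
  qed simp
qed

text \<open>The norm is at most the sum of the \<open>\<bar>w i\<bar>\<close>, hence at most the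
  product of the \<open>1 + \<bar>w i\<bar>\<close>. Powers of this product factor over the
  independent coordinates.\<close>

lemma integrable_std_gaussian_norm_powr:
  assumes q: "0 \<le> q"
  shows "integrable (std_gaussian :: (real ^ 'n::finite) measure) (\<lambda>x. norm x powr q)"
proof -
  have i: "integrable (Pi\<^sub>M UNIV (\<lambda>_::'n. std_normal_distribution)) (\<lambda>w. \<Prod>i\<in>UNIV. (1 + \<bar>w i\<bar>) powr q)"
    by (rule std_normal_product.product_integrable_prod) (auto intro: integrable_std_normal_powr[OF q])
  have sum_le: "(\<Sum>i\<in>J. a i) \<le> (\<Prod>i\<in>J. 1 + a i)" if "finite J" "\<And>i. 0 \<le> a i" for a :: "'n \<Rightarrow> real" and J
  proof -
    have "1 + (\<Sum>i\<in>J. a i) \<le> (\<Prod>i\<in>J. 1 + a i)"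
      using that(1)
    proof (induction J rule: finite_induct)
      case (insert j J)
      have "1 + (a j + sum a J) \<le> (1 + a j) * (1 + sum a J)"
        using that(2) by (simp add: algebra_simps sum_nonneg)
      also have "\<dots> \<le> (1 + a j) * (\<Prod>i\<in>J. 1 + a i)"
        using insert that(2)[of j] by (intro mult_left_mono) auto
      finally show ?case using insert by simp
    qed simp
    then show ?thesis by simp
  qed
  have "integrable (Pi\<^sub>M UNIV (\<lambda>_::'n. std_normal_distribution)) (\<lambda>w. norm (coords UNIV w) powr q)"
  proof (rule Bochner_Integration.integrable_bound[OF i])
    show "AE w in Pi\<^sub>M UNIV (\<lambda>_::'n. std_normal_distribution). norm (norm (coords UNIV w) powr q) \<le> norm (\<Prod>i\<in>UNIV. (1 + \<bar>w i\<bar>) powr q)"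
    proof (rule AE_I2)
      fix w :: "'n \<Rightarrow> real"
      have "norm (coords UNIV w) \<le> (\<Sum>i\<in>UNIV. \<bar>w i\<bar>)"
        using norm_le_l1_cart[of "coords UNIV w"] by (simp add: coords_def)
      also have "\<dots> \<le> (\<Prod>i\<in>UNIV. 1 + \<bar>w i\<bar>)" by (rule sum_le) auto
      finally have "norm (coords UNIV w) powr q \<le> (\<Prod>i\<in>UNIV. 1 + \<bar>w i\<bar>) powr q"
        using q by (intro powr_mono2) auto
      also have "\<dots> = (\<Prod>i\<in>UNIV. (1 + \<bar>w i\<bar>) powr q)"
        by (rule prod_powr_distrib)
      finally show "norm (norm (coords UNIV w) powr q) \<le> norm (\<Prod>i\<in>UNIV. (1 + \<bar>w i\<bar>) powr q)"
        by simp
    qed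
  qed simp
  then show ?thesis
    unfolding std_gaussian_eq_distr by (subst integrable_distr_eq) auto
qed

lemma norm_proj_le:
  assumes "K \<in> closed_convex_cones"
  shows "norm (closest_point K x) \<le> norm x"
proof -
  have "(norm (closest_point K x))\<^sup>2 \<le> norm x * norm (closest_point K x)"
    using inner_proj[OF assms, of x] norm_cauchy_schwarz[of x "closest_point K x"] by simp
  then show ?thesis
    by (cases "closest_point K x = 0") (simp_all add: power2_eq_square)
qed

lemma integrable_proj_powr:
  fixes K :: "(real ^ 'n::finite) set"
  assumes K: "K \<in> closed_convex_cones" and q: "0 \<le> q"
  shows "integrable std_gaussian (\<lambda>x. norm (closest_point K x) powr q)"
proof (rule Bochner_Integration.integrable_bound[OF integrable_std_gaussian_norm_powr[OF q]])
  have [measurable]: "closest_point K \<in> borel_measurable borel" by (rule borel_measurable_proj[OF K])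
  show "(\<lambda>x. norm (closest_point K x) powr q) \<in> borel_measurable std_gaussian" by simp
  show "AE x in std_gaussian. norm (norm (closest_point K x) powr q) \<le> norm (norm x powr q)"
    using norm_proj_le[OF K] q by (auto intro!: powr_mono2)
qed

section \<open>Comparison of moments\<close>

text \<open>Formulated with \<open>has_bochner_integral\<close> so that the formulas for two
  variables can be subtracted, giving an integral of the tail difference.\<close>

lemma (in prob_space) layer_cake:
  fixes X :: "'a \<Rightarrow> real"
  assumes [measurable]: "X \<in> borel_measurable M" and X: "\<And>x. 0 \<le> X x" and p: "0 < p"
    and i: "integrable M (\<lambda>x. X x powr p)"
  shows "has_bochner_integral lborel
    (\<lambda>t. indicator {0..} t * (t powr (p - 1) * prob {x \<in> space M. t < X x}))
    (expectation (\<lambda>x. X x powr p) / p)"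
proof (rule has_bochner_integral_nn_integral)
  interpret P: pair_sigma_finite M lborel ..
  have "mono (\<lambda>t. - prob {x \<in> space M. t < X x})"
    by (rule monoI) (auto intro!: finite_measure_mono)
  from borel_measurable_uminus[OF borel_measurable_mono[OF this]]
  have [measurable]: "(\<lambda>t. prob {x \<in> space M. t < X x}) \<in> borel_measurable borel" by simp
  show "(\<lambda>t. indicator {0..} t * (t powr (p - 1) * prob {x \<in> space M. t < X x})) \<in> borel_measurable lborel"
    by simp
  show "0 \<le> expectation (\<lambda>x. X x powr p) / p" using p by (simp add: integral_nonneg)
  have "(\<integral>\<^sup>+t. ennreal (indicator {0..} t * (t powr (p - 1) * prob {x \<in> space M. t < X x})) \<partial>lborel)
      = (\<integral>\<^sup>+t. \<integral>\<^sup>+x. ennreal (indicator {0..} t * t powr (p - 1)) * indicator {x \<in> space M. t < X x} x \<partial>M \<partial>lborel)"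
    by (intro nn_integral_cong, subst nn_integral_cmult_indicator)
       (auto simp: emeasure_eq_measure mult.assoc simp flip: ennreal_mult)
  also have "\<dots> = (\<integral>\<^sup>+t. \<integral>\<^sup>+x. ennreal (indicator {0..} t * t powr (p - 1)) * (if t < X x then 1 else 0) \<partial>M \<partial>lborel)"
    by (intro nn_integral_cong) (auto simp: indicator_def)
  also have "\<dots> = (\<integral>\<^sup>+x. \<integral>\<^sup>+t. ennreal (indicator {0..} t * t powr (p - 1)) * (if t < X x then 1 else 0) \<partial>lborel \<partial>M)"
    by (rule P.Fubini') simp
  also have "\<dots> = (\<integral>\<^sup>+x. ennreal (X x powr p / p) \<partial>M)"
  proof (rule nn_integral_cong)
    fix x
    have "(\<integral>\<^sup>+t. ennreal (indicator {0..} t * t powr (p - 1)) * (if t < X x then 1 else 0) \<partial>lborel)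
        = (\<integral>\<^sup>+t. ennreal (t powr (p - 1)) * indicator {0..X x} t \<partial>lborel)"
      using AE_lborel_singleton[of "X x"]
      by (intro nn_integral_cong_AE) (auto elim!: eventually_mono simp: indicator_def)
    also have "\<dots> = ennreal (X x powr (p - 1 + 1) / (p - 1 + 1))"
      by (rule nn_integral_has_integral_lebesgue'[OF _ has_integral_powr_from_0]) (use p X in auto)
    finally show "(\<integral>\<^sup>+t. ennreal (indicator {0..} t * t powr (p - 1)) * (if t < X x then 1 else 0) \<partial>lborel)
        = ennreal (X x powr p / p)" by simp
  qed
  also have "\<dots> = ennreal (expectation (\<lambda>x. X x powr p) / p)"
    using i p by (subst nn_integral_eq_integral) auto
  finally show "(\<integral>\<^sup>+t. ennreal (indicator {0..} t * (t powr (p - 1) * prob {x \<in> space M. t < X x})) \<partial>lborel)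
      = ennreal (expectation (\<lambda>x. X x powr p) / p)" .
qed (auto intro!: always_eventually)

text \<open>With equal \<open>p\<close>-th moments the tail difference \<open>D\<close> integrates to zero against
  \<open>t powr (p - 1)\<close>, and \<open>t powr (q - 1) - c powr (q - p) * t powr (p - 1)\<close> changes sign exactly where
  \<open>D\<close> does.\<close>

lemma (in prob_space) moment_comparison_crossing:
  fixes X Y :: "'a \<Rightarrow> real"
  assumes [measurable]: "X \<in> borel_measurable M" "Y \<in> borel_measurable M"
    and X: "\<And>x. 0 \<le> X x" and Y: "\<And>x. 0 \<le> Y x" and p: "0 < p" and q: "p < q"
    and Xi: "\<And>r. 0 < r \<Longrightarrow> integrable M (\<lambda>x. X x powr r)"
    and Yi: "\<And>r. 0 < r \<Longrightarrow> integrable M (\<lambda>x. Y x powr r)"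
    and eq: "expectation (\<lambda>x. X x powr p) = expectation (\<lambda>x. Y x powr p)"
    and cross: "\<And>s t. 0 \<le> s \<Longrightarrow> s \<le> t \<Longrightarrow> prob {x \<in> space M. Y x \<le> s} \<le> prob {x \<in> space M. X x \<le> s} \<Longrightarrow>
      prob {x \<in> space M. Y x \<le> t} \<le> prob {x \<in> space M. X x \<le> t}"
  shows "expectation (\<lambda>x. X x powr q) \<le> expectation (\<lambda>x. Y x powr q)"
proof -
  define D where "D t = prob {x \<in> space M. t < X x} - prob {x \<in> space M. t < Y x}" for t
  have compl: "prob {x \<in> space M. t < Z x} = 1 - prob {x \<in> space M. Z x \<le> t}"
    if [measurable]: "Z \<in> borel_measurable M" for Z :: "'a \<Rightarrow> real" and t
  proof -
    have "{x \<in> space M. t < Z x} = space M - {x \<in> space M. Z x \<le> t}" by auto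
    then show ?thesis using prob_compl[of "{x \<in> space M. Z x \<le> t}"] by simp
  qed
  have D: "D t \<le> 0 \<longleftrightarrow> prob {x \<in> space M. Y x \<le> t} \<le> prob {x \<in> space M. X x \<le> t}" for t
    by (simp add: D_def compl)
  have int: "has_bochner_integral lborel (\<lambda>t. indicator {0..} t * (t powr (r - 1) * D t))
      ((expectation (\<lambda>x. X x powr r) - expectation (\<lambda>x. Y x powr r)) / r)" if "0 < r" for r
    using has_bochner_integral_diff[OF layer_cake[OF _ X that Xi[OF that]] layer_cake[OF _ Y that Yi[OF that]]]
    by (simp add: D_def algebra_simps diff_divide_distrib)
  have Ip: "(\<integral>t. indicator {0..} t * (t powr (p - 1) * D t) \<partial>lborel) = 0"
    using has_bochner_integral_integral_eq[OF int[OF p]] eq by simp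
  \<comment> \<open>If \<open>D\<close> were positive on the whole half-line, its weighted integral
    could not vanish, contrary to \<open>Ip\<close>.\<close>
  have ex: "\<exists>t\<ge>0. D t \<le> 0"
  proof (rule ccontr)
    assume "\<not> ?thesis"
    then have pos: "0 < D t" if "0 \<le> t" for t using that by force
    have "AE t in lborel. indicator {0..} t * (t powr (p - 1) * D t) = 0"
      using Ip integrable.intros[OF int[OF p]] pos
      by (subst (asm) integral_nonneg_eq_0_iff_AE) (auto simp: indicator_def less_imp_le)
    then have "AE t in lborel. t \<notin> {0<..<1 :: real}"
      using pos by (auto elim!: eventually_mono simp: indicator_def split: if_splits)
        (metis less_eq_real_def less_irrefl powr_gt_zero)
    then have "emeasure lborel {0<..<1 :: real} = 0"
      by (subst (asm) AE_iff_null_sets[symmetric]) auto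
    then show False by simp
  qed
  \<comment> \<open>By \<open>cross\<close> the set \<open>S\<close> is closed upwards in the
    half-line, so its infimum \<open>c\<close> is the crossing point. The sign of \<open>D\<close>
    at \<open>c\<close> itself is left open, a null set.\<close>
  define S where "S = {t. 0 \<le> t \<and> D t \<le> 0}"
  define c where "c = Inf S"
  have S: "S \<noteq> {}" "bdd_below S" using ex by (auto simp: S_def intro!: bdd_belowI[of _ 0])
  have c0: "0 \<le> c" unfolding c_def by (rule cInf_greatest[OF S(1)]) (simp add: S_def)
  have below: "0 < D t" if "0 \<le> t" "t < c" for t
    using cInf_lower[OF _ S(2), of t] that by (force simp: S_def c_def)
  have above: "D t \<le> 0" if "c < t" for t
  proof -
    obtain s where "s \<in> S" "s < t" using cInf_lessD[OF S(1), folded c_def, OF \<open>c < t\<close>] by blast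
    then show ?thesis using cross[of s t] D by (auto simp: S_def)
  qed
  have "(\<integral>t. indicator {0..} t * (t powr (q - 1) * D t) \<partial>lborel)
      \<le> (\<integral>t. c powr (q - p) * (indicator {0..} t * (t powr (p - 1) * D t)) \<partial>lborel)"
  proof (rule integral_mono_AE)
    show "integrable lborel (\<lambda>t. indicator {0..} t * (t powr (q - 1) * D t))"
      using int[of q] p q by (auto simp: has_bochner_integral_iff)
    show "integrable lborel (\<lambda>t. c powr (q - p) * (indicator {0..} t * (t powr (p - 1) * D t)))"
      using int[of p] p by (intro integrable_mult_right) (auto simp: has_bochner_integral_iff)
    show "AE t in lborel. indicator {0..} t * (t powr (q - 1) * D t) \<le> c powr (q - p) * (indicator {0..} t * (t powr (p - 1) * D t))"
      using AE_lborel_singleton[of c]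
    proof eventually_elim
      case (elim t)
      show ?case
      proof (cases "0 \<le> t")
        case True
        have "(t powr (q - p) - c powr (q - p)) * D t \<le> 0"
        proof (cases "t < c")
          case True
          then show ?thesis
            using below[OF \<open>0 \<le> t\<close>] powr_mono2[of "q - p" t c] q \<open>0 \<le> t\<close>
            by (intro mult_nonpos_nonneg) auto
        next
          case False
          then show ?thesis
            using above[of t] powr_mono2[of "q - p" c t] q elim c0
            by (intro mult_nonneg_nonpos) auto
        qed
        then have "t powr (p - 1) * ((t powr (q - p) - c powr (q - p)) * D t) \<le> 0"
          by (rule mult_nonneg_nonpos[rotated]) simp
        \<comment> \<open>Also valid at \<open>t = 0\<close>, because \<open>0 powr a = 0\<close>
          for every exponent.\<close>
        moreover have "t powr (q - 1) = t powr (p - 1) * t powr (q - p)"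
          by (simp flip: powr_add)
        ultimately show ?thesis using True by (simp add: algebra_simps)
      qed simp
    qed
  qed
  also have "\<dots> = 0" by (simp add: Ip)
  finally have "(expectation (\<lambda>x. X x powr q) - expectation (\<lambda>x. Y x powr q)) / q \<le> 0"
    using has_bochner_integral_integral_eq[OF int[of q]] p q by simp
  then show ?thesis using p q by (simp add: divide_le_0_iff)
qed

section \<open>Half moments of the normal law and comparison with a ray\<close>

lemma integrable_std_normal_abs_powr:
  "0 \<le> q \<Longrightarrow> integrable std_normal_distribution (\<lambda>z. \<bar>z\<bar> powr q)"
  by (rule Bochner_Integration.integrable_bound[OF integrable_std_normal_powr])
     (auto intro!: powr_mono2)

lemma integral_max_std_normal_powr:
  assumes "0 < q"
  shows "(\<integral>z. max 0 z powr q \<partial>std_normal_distribution) = (\<integral>z. \<bar>z\<bar> powr q \<partial>std_normal_distribution) / 2"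
proof -
  have refl: "distr std_normal_distribution borel uminus = std_normal_distribution"
  proof -
    have "std_normal_distribution = density (distr lborel borel uminus) std_normal_density"
      by (simp add: lborel_distr_uminus)
    also have "\<dots> = distr (density lborel (\<lambda>x. std_normal_density (- x))) borel uminus"
      by (subst density_distr) auto
    finally show ?thesis by (simp add: std_normal_density_uminus)
  qed
  have int: "integrable std_normal_distribution (\<lambda>z. \<bar>z\<bar> powr q)"
    using assms by (intro integrable_std_normal_abs_powr) simp
  have i: "integrable std_normal_distribution (\<lambda>z. max 0 z powr q)" "integrable std_normal_distribution (\<lambda>z. max 0 (- z) powr q)"
    by (rule Bochner_Integration.integrable_bound[OF int]; use assms in \<open>auto intro!: powr_mono2\<close>)+
  have "(\<integral>z. max 0 z powr q \<partial>std_normal_distribution) = (\<integral>z. max 0 (- z) powr q \<partial>std_normal_distribution)"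
    by (subst refl[symmetric], subst integral_distr) auto
  moreover have "(\<integral>z. \<bar>z\<bar> powr q \<partial>std_normal_distribution) =
      (\<integral>z. max 0 z powr q + max 0 (- z) powr q \<partial>std_normal_distribution)"
    using assms by (intro Bochner_Integration.integral_cong) (auto simp: max_def abs_if)
  ultimately show ?thesis using i by simp
qed

lemma std_normal_abs_moment_pos:
  assumes "0 < q"
  shows "0 < (\<integral>z. \<bar>z\<bar> powr q \<partial>std_normal_distribution)"
proof -
  have int: "integrable std_normal_distribution (\<lambda>z. \<bar>z\<bar> powr q)"
    using assms by (intro integrable_std_normal_abs_powr) simp
  have "(\<integral>z. \<bar>z\<bar> powr q \<partial>std_normal_distribution) \<noteq> 0"
  proof
    assume "(\<integral>z. \<bar>z\<bar> powr q \<partial>std_normal_distribution) = 0"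
    then have "AE z in std_normal_distribution. \<bar>z\<bar> powr q = 0"
      using int by (subst (asm) integral_nonneg_eq_0_iff_AE) auto
    moreover have "AE z in std_normal_distribution. z \<noteq> 0"
      using AE_lborel_singleton[of "0 :: real"] by (subst AE_density) (auto elim!: eventually_mono)
    ultimately have "AE z in std_normal_distribution. False"
      by eventually_elim simp
    then show False by simp
  qed
  moreover have "0 \<le> (\<integral>z. \<bar>z\<bar> powr q \<partial>std_normal_distribution)" by simp
  ultimately show ?thesis by linarith
qed

lemma integral_proj_ray_powr:
  fixes e :: "real ^ 'n::finite"
  assumes "norm e = 1" "0 < q"
  shows "(\<integral>x. norm (closest_point (ray e) x) powr q \<partial>std_gaussian) = (\<integral>z. \<bar>z\<bar> powr q \<partial>std_normal_distribution) / 2"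
proof -
  have "(\<integral>x. norm (closest_point (ray e) x) powr q \<partial>std_gaussian) =
      (\<integral>z. max 0 z powr q \<partial>distr std_gaussian borel (\<lambda>x. e \<bullet> x))"
    by (subst integral_distr) (auto simp: norm_proj_ray[OF assms(1)])
  then show ?thesis
    by (simp add: distr_std_gaussian_inner[OF assms(1)] integral_max_std_normal_powr[OF assms(2)])
qed

text \<open>The ratio is invariant under scaling, so the projection onto the ray may be multiplied
  by \<open>l\<close> to equalise the \<open>p\<close>-th moments; the crossing lemma then compares
  the \<open>q\<close>-th moments.\<close>

lemma moment_ratio_le_ray:
  fixes K :: "(real ^ 'n::finite) set" and e :: "real ^ 'n"
  assumes K: "K \<in> closed_convex_cones" "K \<noteq> {0}" and pq: "0 < p" "p < q" and e: "norm e = 1"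
  shows "proj_ratio p q std_gaussian K \<le> proj_ratio p q std_gaussian (ray e)"
proof -
  interpret G: prob_space "std_gaussian :: (real ^ 'n) measure" by (rule prob_space_std_gaussian)
  let ?R = "\<lambda>x. norm (closest_point K x)" and ?P = "\<lambda>x. norm (closest_point (ray e) x)"
  obtain u where u: "u \<in> K" "norm u = 1" using nontrivial_cone_unit[OF K] by blast
  note re = ray_closed_convex_cone[OF e] and ru = ray_closed_convex_cone[OF u(2)]
  have [measurable]: "closest_point K \<in> borel_measurable borel" "closest_point (ray e) \<in> borel_measurable borel"
    using borel_measurable_proj K(1) re(1) by auto
  have Ri: "integrable std_gaussian (\<lambda>x. ?R x powr r)" "integrable std_gaussian (\<lambda>x. ?P x powr r)" if "0 < r" for r
    using integrable_proj_powr[OF K(1), of r] integrable_proj_powr[OF re(1), of r] that by auto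
  define m where "m r = (\<integral>x. ?R x powr r \<partial>std_gaussian)" for r
  define a where "a r = (\<integral>x. ?P x powr r \<partial>std_gaussian)" for r
  have ray_cdf: "measure std_gaussian {x. max 0 (v \<bullet> x) \<le> t} = Phi t" if "norm v = 1" "0 \<le> t" for v :: "real ^ 'n" and t
    using measure_std_gaussian_halfspace[OF that(1), of t] that(2) by simp
  have apos: "0 < a r" if "0 < r" for r
    using integral_proj_ray_powr[OF e that] std_normal_abs_moment_pos[OF that] by (simp add: a_def)
  \<comment> \<open>Moments of a ray do not depend on its direction, so \<open>ray e\<close> may be
    replaced by the ray through \<open>u\<close>, whose projection norm is dominated pointwise by
    that of \<open>K\<close>.\<close>
  have am: "a r \<le> m r" if "0 < r" for r
  proof -
    have "a r = (\<integral>x. max 0 (u \<bullet> x) powr r \<partial>std_gaussian)"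
      by (simp add: a_def integral_proj_ray_powr[OF e that] flip: norm_proj_ray[OF u(2)] integral_proj_ray_powr[OF u(2) that])
    also have "\<dots> \<le> m r"
      unfolding m_def using norm_proj_ge_inner[OF K(1) u] that
      by (intro integral_mono' Ri(1)[OF that] powr_mono2) auto
    finally show ?thesis .
  qed
  define l where "l = (m p / a p) powr (1 / p)"
  have l1: "1 \<le> l"
    unfolding l_def using am[OF pq(1)] apos[OF pq(1)] pq by (intro ge_one_powr_ge_zero) auto
  have lp: "l powr p = m p / a p"
    using pq am[OF pq(1)] apos[OF pq(1)] by (simp add: l_def powr_powr)
  have scale: "(\<integral>x. (l * ?P x) powr r \<partial>std_gaussian) = l powr r * a r" for r
    using l1 by (simp add: powr_mult a_def)
  have cdfY: "measure std_gaussian {x. l * ?P x \<le> t} = Phi (t / l)" if "0 \<le> t" for t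
  proof -
    have "l * y \<le> t \<longleftrightarrow> y \<le> t / l" for y using l1 by (simp add: pos_le_divide_eq mult.commute)
    then have "{x. l * ?P x \<le> t} = {x. max 0 (e \<bullet> x) \<le> t / l}"
      by (simp only: norm_proj_ray[OF e])
    then show ?thesis using ray_cdf[OF e, of "t / l"] that l1 by simp
  qed
  have cdfX: "measure std_gaussian {x. ?R x \<le> t} \<le> Phi t" for t
  proof -
    have "measure std_gaussian {x. ?R x \<le> t} \<le> measure std_gaussian {x. u \<bullet> x \<le> t}"
      using norm_proj_ge_inner[OF K(1) u] by (intro G.finite_measure_mono) (auto intro: order_trans)
    then show ?thesis by (simp add: measure_std_gaussian_halfspace[OF u(2)])
  qed
  have mq: "m q \<le> l powr q * a q"
    unfolding scale[symmetric] unfolding m_def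
  proof (rule G.moment_comparison_crossing[OF _ _ _ _ pq])
    show "(\<integral>x. ?R x powr p \<partial>std_gaussian) = (\<integral>x. (l * ?P x) powr p \<partial>std_gaussian)"
      unfolding scale lp using apos[OF pq(1)] by (simp add: m_def)
    show "integrable std_gaussian (\<lambda>x. (l * ?P x) powr r)" if "0 < r" for r
      using Ri(2)[OF that] l1 by (simp add: powr_mult)
    fix s t :: real
    assume st: "0 \<le> s" "s \<le> t"
      and "measure std_gaussian {x \<in> space std_gaussian. l * ?P x \<le> s} \<le> measure std_gaussian {x \<in> space std_gaussian. ?R x \<le> s}"
    then have F: "Phi (s / l) \<le> measure std_gaussian {x. ?R x \<le> s}" by (simp add: cdfY)
    \<comment> \<open>Positivity comes from the crossing assumption, the bound below 1 from
      comparison with the half-space of normal \<open>u\<close>.\<close>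
    have F01: "0 < measure std_gaussian {x. ?R x \<le> s}" "measure std_gaussian {x. ?R x \<le> s} < 1"
      using F Phi_bounds[of "s / l"] cdfX[of s] Phi_bounds[of s] by linarith+
    have "s / l \<le> quantile (measure std_gaussian {x. ?R x \<le> s})"
      using F F01 by (subst Phi_le_iff[symmetric]) (simp add: Phi_quantile)
    \<comment> \<open>This is where \<open>1 \<le> l\<close> enters: the scaled ray gains quantile
      at speed \<open>1 / l\<close>, the cone at least at speed 1.\<close>
    moreover have "(t - s) / l \<le> t - s" using st l1 by (simp add: divide_le_eq mult_le_cancel_left1)
    ultimately have "Phi (t / l) \<le> Phi (quantile (measure std_gaussian {x. ?R x \<le> s}) + (t - s))"
      by (simp add: diff_divide_distrib)
    also have "\<dots> \<le> measure std_gaussian {x. ?R x \<le> t}"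
      by (rule proj_norm_cdf_isoperimetry[OF K(1) st(2) F01])
    finally show "measure std_gaussian {x \<in> space std_gaussian. l * ?P x \<le> t} \<le> measure std_gaussian {x \<in> space std_gaussian. ?R x \<le> t}"
      using st by (simp add: cdfY)
  qed (use l1 Ri in auto)
  have mp: "0 < m p" using am[OF pq(1)] apos[OF pq(1)] by linarith
  have "m q powr (1 / q) \<le> (l powr q * a q) powr (1 / q)"
    using mq pq by (intro powr_mono2) (auto simp: m_def)
  also have "\<dots> = l * a q powr (1 / q)"
    using pq l1 apos[of q] by (simp add: powr_mult powr_powr)
  finally have "m q powr (1 / q) / m p powr (1 / p) \<le> l * a q powr (1 / q) / m p powr (1 / p)"
    by (rule divide_right_mono) simp
  also have "\<dots> = a q powr (1 / q) / a p powr (1 / p)"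
    using mp apos[OF pq(1)] by (simp add: l_def powr_divide)
  finally show ?thesis by (simp add: proj_ratio_def Lp_norm_def m_def a_def)
qed

section \<open>Polar coordinates and the sphere\<close>

lemma nn_integral_lborel_scaleR:
  fixes f :: "'a::euclidean_space \<Rightarrow> ennreal"
  assumes [measurable]: "f \<in> borel_measurable borel" and r: "0 < r"
  shows "(\<integral>\<^sup>+x. f x \<partial>lborel) = ennreal (r ^ DIM('a)) * (\<integral>\<^sup>+x. f (r *\<^sub>R x) \<partial>lborel)"
  using r
  by (subst lborel_affine[of r 0])
     (simp_all add: nn_integral_density nn_integral_distr nn_integral_cmult ennreal_power flip: ennreal_power)

text \<open>Integration in polar coordinates without surface measure: since \<open>\<phi>\<close> depends on the direction only,
  its angular average is its average over the unit ball.\<close>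

lemma nn_integral_radial_times_angular:
  fixes \<phi> :: "'a::euclidean_space \<Rightarrow> ennreal" and w :: "real \<Rightarrow> ennreal"
  assumes [measurable]: "\<phi> \<in> borel_measurable borel" "w \<in> borel_measurable borel"
    and hom: "\<And>c x. 0 < c \<Longrightarrow> \<phi> (c *\<^sub>R x) = \<phi> x" and le1: "\<And>x. \<phi> x \<le> 1"
  shows "(\<integral>\<^sup>+x. w (norm x) * \<phi> x \<partial>lborel) =
    (\<integral>\<^sup>+x. w (norm x) \<partial>(lborel :: 'a measure)) * (\<integral>\<^sup>+x. \<phi> x \<partial>uniform_measure lborel (ball 0 1))"
proof -
  let ?B = "ball (0 :: 'a) 1"
  define C where "C = (\<integral>\<^sup>+x. \<phi> x \<partial>uniform_measure lborel ?B)"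
  have Bpos: "emeasure lborel ?B \<noteq> 0" "emeasure lborel ?B \<noteq> \<infinity>"
  proof -
    have "measure lborel ?B > 0" by (simp add: content_ball_pos)
    then show "emeasure lborel ?B \<noteq> 0" by (auto simp: measure_def)
    show "emeasure lborel ?B \<noteq> \<infinity>" using emeasure_lborel_ball_finite[of "0::'a" 1] by simp
  qed
  have CB: "(\<integral>\<^sup>+x. \<phi> x * indicator ?B x \<partial>lborel) = C * emeasure lborel ?B"
    using Bpos
    by (simp add: C_def nn_integral_uniform_measure ennreal_divide_times ennreal_divide_self less_top)
  \<comment> \<open>Scaling by \<open>r\<close> multiplies Lebesgue measure by
    \<open>r ^ DIM('a)\<close> and leaves \<open>\<phi>\<close> unchanged, so the average of
    \<open>\<phi>\<close> over a centred ball does not depend on the radius.\<close>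
  have ball: "(\<integral>\<^sup>+x. \<phi> x * indicator {..<r} (norm x) \<partial>lborel) = C * (\<integral>\<^sup>+x. indicator {..<r} (norm x) \<partial>(lborel :: 'a measure))"
    for r
  proof (cases "0 < r")
    case True
    have ind: "indicator {..<r} (norm (r *\<^sub>R x)) = (indicator ?B x :: ennreal)" for x :: 'a
      using True by (simp add: indicator_def dist_norm abs_of_pos)
    have m: "(\<lambda>x :: 'a. indicator {..<r} (norm x) :: ennreal) \<in> borel_measurable borel"
      by (rule measurable_compose[of norm _ borel]) auto
    then have m2: "(\<lambda>x. \<phi> x * indicator {..<r} (norm x)) \<in> borel_measurable borel"
      by measurable
    have "(\<integral>\<^sup>+x. \<phi> x * indicator {..<r} (norm x) \<partial>lborel) = ennreal (r ^ DIM('a)) * (C * emeasure lborel ?B)"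
      using nn_integral_lborel_scaleR[OF m2 True] by (simp only: ind hom[OF True] CB)
    moreover have "(\<integral>\<^sup>+x. indicator {..<r} (norm x) \<partial>(lborel :: 'a measure)) = ennreal (r ^ DIM('a)) * emeasure lborel ?B"
      using nn_integral_lborel_scaleR[OF m True] by (simp only: ind) simp
    ultimately show ?thesis by (simp add: mult_ac)
  next
    case False
    then have "indicator {..<r} (norm x) = (0 :: ennreal)" for x :: 'a
      using norm_ge_zero[of x] by (auto simp: indicator_def simp del: norm_ge_zero)
    then show ?thesis by simp
  qed
  have C1: "C \<le> 1"
  proof -
    interpret prob_space "uniform_measure lborel ?B" by (rule prob_space_uniform_ball)
    have "C \<le> (\<integral>\<^sup>+x. 1 \<partial>uniform_measure lborel ?B)" unfolding C_def by (intro nn_integral_mono le1)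
    then show ?thesis using emeasure_space_1 by simp
  qed
  \<comment> \<open>Equality on all balls says that the radial laws of the densities
    \<open>\<phi>\<close> and \<open>C\<close> agree on the half-lines, an intersection-stable
    generator; hence \<open>w\<close> may be integrated against either.\<close>
  have "distr (density lborel \<phi>) borel norm = distr (density lborel (\<lambda>_ :: 'a. C)) borel norm" (is "?M = ?N")
  proof (rule measure_eqI_generator_eq[where E = "range lessThan" and \<Omega> = UNIV and A = "\<lambda>n. {..<real n}"])
    show "Int_stable (range (lessThan :: real \<Rightarrow> real set))"
    proof (rule Int_stableI)
      fix A B :: "real set" assume "A \<in> range lessThan" "B \<in> range lessThan"
      then obtain a b where "A = {..<a}" "B = {..<b}" by blast
      then have "A \<inter> B = {..<min a b}" by auto
      then show "A \<inter> B \<in> range lessThan" by blast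
    qed
    have [simp]: "norm -` {..<r} \<in> sets (borel :: 'a measure)" for r
      using measurable_sets[of norm "borel :: 'a measure" borel "{..<r}"] by simp
    have ind: "indicator (norm -` {..<r}) x = (indicator {..<r} (norm x) :: ennreal)" for r and x :: 'a
      by (simp add: indicator_def)
    have M: "emeasure ?M {..<r} = (\<integral>\<^sup>+x. \<phi> x * indicator {..<r} (norm x) \<partial>lborel)" for r
      by (simp add: emeasure_distr emeasure_density ind)
    have N: "emeasure ?N {..<r} = C * (\<integral>\<^sup>+x. indicator {..<r} (norm x) \<partial>(lborel :: 'a measure))" for r
      by (simp add: emeasure_distr emeasure_density nn_integral_cmult_indicator flip: ind)
    show "emeasure ?M X = emeasure ?N X" if "X \<in> range lessThan" for X
      using that M N ball by auto
    have borel: "sets (borel :: real measure) = sigma_sets UNIV (range lessThan)"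
      by (subst borel_eq_lessThan) (simp add: eucl_less_def lessThan_def)
    show "sets ?M = sigma_sets UNIV (range lessThan)" "sets ?N = sigma_sets UNIV (range lessThan)"
      using borel by simp_all
    show "(\<Union>i. {..<real i}) = UNIV" using reals_Archimedean2 by auto
    show "emeasure ?M {..<real i} \<noteq> \<infinity>" for i
    proof -
      have "(\<integral>\<^sup>+x. indicator {..<real i} (norm x) \<partial>(lborel :: 'a measure)) = emeasure lborel (ball (0::'a) (real i))"
      proof -
        have "indicator {..<real i} (norm x) = (indicator (ball 0 (real i)) x :: ennreal)" for x :: 'a
          by (simp add: indicator_def)
        then show ?thesis by simp
      qed
      then show ?thesis
        using C1 emeasure_lborel_ball_finite[of "0::'a" "real i"]
        by (simp add: M ball ennreal_mult_eq_top_iff) (auto simp: top_unique)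
    qed
  qed auto
  then have "(\<integral>\<^sup>+r. w r \<partial>?M) = (\<integral>\<^sup>+r. w r \<partial>?N)" by (rule arg_cong)
  then have "(\<integral>\<^sup>+x. \<phi> x * w (norm x) \<partial>lborel) = (\<integral>\<^sup>+x. C * w (norm x) \<partial>(lborel :: 'a measure))"
    by (simp add: nn_integral_distr nn_integral_density)
  then show ?thesis by (simp add: nn_integral_multc C_def mult.commute)
qed

section \<open>Passage from the Gaussian measure to the sphere\<close>

lemma proj_scaleR:
  fixes K :: "'a::euclidean_space set"
  assumes K: "K \<in> closed_convex_cones" and c: "0 < c"
  shows "closest_point K (c *\<^sub>R x) = c *\<^sub>R closest_point K x"
proof (rule closest_point_unique[OF ccc_convex[OF K] ccc_closed[OF K], symmetric])
  show "c *\<^sub>R closest_point K x \<in> K"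
    using ccc_cone[OF K] proj_in_cone[OF K] c by (simp add: cone_def)
  have scale: "dist (c *\<^sub>R a) (c *\<^sub>R b) = c * dist a b" for a b :: 'a
    using c by (simp add: dist_norm flip: scaleR_diff_right)
  show "\<forall>z\<in>K. dist (c *\<^sub>R x) (c *\<^sub>R closest_point K x) \<le> dist (c *\<^sub>R x) z"
  proof
    fix z assume "z \<in> K"
    then have "z /\<^sub>R c \<in> K" using ccc_cone[OF K] c by (simp add: cone_def)
    then have "dist x (closest_point K x) \<le> dist x (z /\<^sub>R c)"
      by (rule closest_point_le[OF ccc_closed[OF K]])
    then have "dist (c *\<^sub>R x) (c *\<^sub>R closest_point K x) \<le> c * dist x (z /\<^sub>R c)"
      using c by (simp add: scale)
    also have "\<dots> = dist (c *\<^sub>R x) (c *\<^sub>R (z /\<^sub>R c))" by (simp only: scale)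
    also have "c *\<^sub>R (z /\<^sub>R c) = z" using c by simp
    finally show "dist (c *\<^sub>R x) (c *\<^sub>R closest_point K x) \<le> dist (c *\<^sub>R x) z" .
  qed
qed

lemma proj_zero: "K \<in> closed_convex_cones \<Longrightarrow> closest_point K 0 = 0"
  using norm_proj_le[of K 0] by simp

lemma norm_proj_polar:
  assumes "K \<in> closed_convex_cones"
  shows "norm (closest_point K x) = norm x * norm (closest_point K (x /\<^sub>R norm x))"
proof (cases "x = 0")
  case False
  then show ?thesis
    using proj_scaleR[OF assms, of "norm x" "x /\<^sub>R norm x"] by simp
qed (simp add: proj_zero[OF assms])

text \<open>By homogeneity the integrand is a power of the norm times a function of the direction,
  and the Gaussian density depends on the norm only. This is the independence of norm and direction
  in integrated form.\<close>

lemma integral_proj_std_gaussian_eq_sphere: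
  fixes K :: "(real ^ 'n::finite) set"
  assumes K: "K \<in> closed_convex_cones" and p: "0 < p"
  shows "(\<integral>x. norm (closest_point K x) powr p \<partial>std_gaussian) =
    (\<integral>x. norm x powr p \<partial>(std_gaussian :: (real ^ 'n) measure)) * (\<integral>x. norm (closest_point K x) powr p \<partial>uniform_sphere)"
proof -
  let ?U = "uniform_measure lborel (ball (0 :: real ^ 'n) 1)"
  have [measurable]: "closest_point K \<in> borel_measurable borel" by (rule borel_measurable_proj[OF K])
  interpret G: prob_space "std_gaussian :: (real ^ 'n) measure" by (rule prob_space_std_gaussian)
  interpret U: prob_space ?U by (rule prob_space_uniform_ball)
  define \<phi> where "\<phi> x = norm (closest_point K (x /\<^sub>R norm x)) powr p" for x
  define g where "g r = (1 / sqrt (2 * pi)) ^ CARD('n) * exp (- r\<^sup>2 / 2)" for r :: real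
  have [measurable]: "\<phi> \<in> borel_measurable borel" "g \<in> borel_measurable borel"
    unfolding \<phi>_def g_def by measurable
  have g0: "0 \<le> g r" for r by (simp add: g_def)
  have \<phi>1: "0 \<le> \<phi> x" "\<phi> x \<le> 1" for x
  proof -
    have "norm (closest_point K (x /\<^sub>R norm x)) \<le> 1"
      using order_trans[OF norm_proj_le[OF K, of "x /\<^sub>R norm x"], of 1] by (cases "x = 0") auto
    then show "\<phi> x \<le> 1" using powr_mono2[of p _ 1] p by (simp add: \<phi>_def)
  qed (simp add: \<phi>_def)
  have dens: "(\<Prod>i\<in>UNIV. std_normal_density (x $ i)) = g (norm x)" for x :: "real ^ 'n"
  proof -
    have "(\<Prod>i\<in>UNIV. std_normal_density (x $ i)) = (1 / sqrt (2 * pi)) ^ CARD('n) * exp (\<Sum>i\<in>UNIV. - (x $ i)\<^sup>2 / 2)"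
      by (simp add: std_normal_density_def prod.distrib exp_sum prod_dividef power_one_over)
    also have "(\<Sum>i\<in>UNIV. - (x $ i)\<^sup>2 / 2) = - (norm x)\<^sup>2 / 2"
      by (simp add: norm_vec_def L2_set_def sum_nonneg sum_negf flip: sum_divide_distrib)
    finally show ?thesis by (simp add: g_def)
  qed
  have G: "(\<integral>\<^sup>+x. f x \<partial>std_gaussian) = (\<integral>\<^sup>+x. ennreal (g (norm x)) * f x \<partial>lborel)"
    if [measurable]: "f \<in> borel_measurable borel" for f :: "real ^ 'n \<Rightarrow> ennreal"
    unfolding std_gaussian_def dens by (subst nn_integral_density) auto
  have "(\<integral>\<^sup>+x. ennreal (norm (closest_point K x) powr p) \<partial>std_gaussian)
      = (\<integral>\<^sup>+x. ennreal (g (norm x) * norm x powr p) * ennreal (\<phi> x) \<partial>lborel)"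
    by (subst G, simp, intro nn_integral_cong, subst norm_proj_polar[OF K])
       (simp add: powr_mult \<phi>_def g0 mult.assoc flip: ennreal_mult)
  also have "\<dots> = (\<integral>\<^sup>+x. ennreal (g (norm x) * norm x powr p) \<partial>(lborel :: (real ^ 'n) measure)) * (\<integral>\<^sup>+x. ennreal (\<phi> x) \<partial>?U)"
  proof (rule nn_integral_radial_times_angular)
    fix c :: real and x :: "real ^ 'n" assume "0 < c"
    then have "(c *\<^sub>R x) /\<^sub>R norm (c *\<^sub>R x) = x /\<^sub>R norm x" by (simp add: field_simps)
    then show "ennreal (\<phi> (c *\<^sub>R x)) = ennreal (\<phi> x)" by (simp only: \<phi>_def)
  qed (use \<phi>1 in auto)
  also have "(\<integral>\<^sup>+x. ennreal (g (norm x) * norm x powr p) \<partial>(lborel :: (real ^ 'n) measure)) = (\<integral>\<^sup>+x. ennreal (norm x powr p) \<partial>(std_gaussian :: (real ^ 'n) measure))"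
    by (subst G) (auto simp: ennreal_mult' g0)
  also have "\<dots> = ennreal (\<integral>x. norm x powr p \<partial>(std_gaussian :: (real ^ 'n) measure))"
    using p by (intro nn_integral_eq_integral integrable_std_gaussian_norm_powr) auto
  also have "(\<integral>\<^sup>+x. ennreal (\<phi> x) \<partial>?U) = ennreal (\<integral>x. \<phi> x \<partial>?U)"
    using \<phi>1 by (intro nn_integral_eq_integral U.integrable_const_bound[where B = 1]) auto
  also have "(\<integral>x. \<phi> x \<partial>?U) = (\<integral>x. norm (closest_point K x) powr p \<partial>uniform_sphere)"
    unfolding uniform_sphere_def \<phi>_def by (subst integral_distr) auto
  also have "(\<integral>\<^sup>+x. ennreal (norm (closest_point K x) powr p) \<partial>std_gaussian) = ennreal (\<integral>x. norm (closest_point K x) powr p \<partial>std_gaussian)"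
    using p by (intro nn_integral_eq_integral integrable_proj_powr K) auto
  finally show ?thesis
    by (subst (asm) ennreal_mult[symmetric]) (auto intro!: integral_nonneg simp: ennreal_inj)
qed

text \<open>Bounded below by the moment of the projection onto a coordinate ray, already known to be
  positive.\<close>

lemma integral_norm_std_gaussian_pos:
  assumes "0 < p"
  shows "0 < (\<integral>x. norm x powr p \<partial>(std_gaussian :: (real ^ 'n::finite) measure))"
proof -
  obtain i :: 'n where True by simp
  define e :: "real ^ 'n" where "e = axis i 1"
  have e: "norm e = 1" by (simp add: e_def norm_axis_1)
  have "0 < (\<integral>x. norm (closest_point (ray e) x) powr p \<partial>std_gaussian)"
    using integral_proj_ray_powr[OF e assms] std_normal_abs_moment_pos[OF assms] by simp
  also have "\<dots> \<le> (\<integral>x. norm x powr p \<partial>(std_gaussian :: (real ^ 'n) measure))"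
    using assms norm_proj_le[OF ray_closed_convex_cone(1)[OF e]]
    by (intro integral_mono' integrable_std_gaussian_norm_powr powr_mono2) auto
  finally show ?thesis .
qed

text \<open>The divisor does not depend on \<open>K\<close>, so Gaussian and spherical ratios have
  the same maximisers.\<close>

lemma proj_ratio_sphere:
  fixes K :: "(real ^ 'n::finite) set"
  assumes K: "K \<in> closed_convex_cones" and "0 < p" "0 < q"
  shows "proj_ratio p q uniform_sphere K = proj_ratio p q std_gaussian K /
    (Lp_norm (std_gaussian :: (real ^ 'n) measure) q (\<lambda>x. norm x) / Lp_norm (std_gaussian :: (real ^ 'n) measure) p (\<lambda>x. norm x))"
proof -
  have *: "Lp_norm std_gaussian r (closest_point K) =
      Lp_norm (std_gaussian :: (real ^ 'n) measure) r (\<lambda>x. norm x) * Lp_norm uniform_sphere r (closest_point K)"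
    "0 < Lp_norm (std_gaussian :: (real ^ 'n) measure) r (\<lambda>x. norm x)" if "0 < r" for r
    using integral_norm_std_gaussian_pos[OF that, where 'n = 'n] that
    by (simp_all add: Lp_norm_def integral_proj_std_gaussian_eq_sphere[OF K that] powr_mult integral_nonneg)
  show ?thesis
    using *(2)[OF \<open>0 < p\<close>] *(2)[OF \<open>0 < q\<close>]
    by (simp add: proj_ratio_def *(1)[OF \<open>0 < p\<close>] *(1)[OF \<open>0 < q\<close>] field_simps)
qed

theorem theorem6p5:
  fixes p q :: real
    and i :: "'n::finite"
    and M :: "'a measure" and Z :: "'a \<Rightarrow> real"
    and N :: "'b measure" and X :: "'b \<Rightarrow> real"
  assumes "1 \<le> p" and "p < q"
    and "prob_space M" and "distributed M lborel Z std_normal_density"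
    and "prob_space N" and "X \<in> borel_measurable N"
    and "distr N borel X = distr (std_gaussian :: (real ^ 'n) measure) borel norm"
  shows
    "A_star p q (std_gaussian :: (real ^ 'n) measure) =
           ereal (2 powr (1 / p - 1 / q) * (Lp_norm M q Z / Lp_norm M p Z))
     \<and> A_star p q (uniform_sphere :: (real ^ 'n) measure) =
           ereal (2 powr (1 / p - 1 / q) *
             ((Lp_norm M q Z / Lp_norm M p Z) / (Lp_norm N q X / Lp_norm N p X)))
     \<and> ray (axis i 1 :: real ^ 'n) \<in> closed_convex_cones - {{0}}
     \<and> ereal (proj_ratio p q (std_gaussian :: (real ^ 'n) measure) (ray (axis i 1))) =
           A_star p q (std_gaussian :: (real ^ 'n) measure)
     \<and> ereal (proj_ratio p q (uniform_sphere :: (real ^ 'n) measure) (ray (axis i 1))) =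
           A_star p q (uniform_sphere :: (real ^ 'n) measure)"
proof -
  define e :: "real ^ 'n" where "e = axis i 1"
  have e: "norm e = 1" by (simp add: e_def norm_axis_1)
  have pq: "0 < p" "0 < q" using assms(1,2) by auto
  have ray: "ray e \<in> closed_convex_cones - {{0}}" using ray_closed_convex_cone[OF e] by simp
  define c where "c = Lp_norm (std_gaussian :: (real ^ 'n) measure) q (\<lambda>x. norm x) /
    Lp_norm (std_gaussian :: (real ^ 'n) measure) p (\<lambda>x. norm x)"
  have c: "0 \<le> c" by (simp add: c_def Lp_norm_def)
  have sphere: "proj_ratio p q uniform_sphere K = proj_ratio p q std_gaussian K / c"
    if "K \<in> closed_convex_cones" for K :: "(real ^ 'n) set"
    unfolding c_def by (rule proj_ratio_sphere[OF that pq])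
  have max: "proj_ratio p q std_gaussian K \<le> proj_ratio p q std_gaussian (ray e)"
    if "K \<in> closed_convex_cones - {{0}}" for K :: "(real ^ 'n) set"
    using moment_ratio_le_ray[OF _ _ pq(1) \<open>p < q\<close> e] that by blast
  have A1: "A_star p q (std_gaussian :: (real ^ 'n) measure) = ereal (proj_ratio p q std_gaussian (ray e))"
    unfolding A_star_def by (intro antisym SUP_least SUP_upper ray) (use max in simp)
  have A2: "A_star p q (uniform_sphere :: (real ^ 'n) measure) = ereal (proj_ratio p q uniform_sphere (ray e))"
    unfolding A_star_def
  proof (intro antisym SUP_least SUP_upper ray)
    fix K :: "(real ^ 'n) set" assume K: "K \<in> closed_convex_cones - {{0}}"
    then show "ereal (proj_ratio p q uniform_sphere K) \<le> ereal (proj_ratio p q uniform_sphere (ray e))"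
      using max[OF K] c ray by (simp add: sphere divide_right_mono)
  qed
  have Z: "Lp_norm M r Z = (\<integral>z. \<bar>z\<bar> powr r \<partial>std_normal_distribution) powr (1 / r)" for r
    using distributed_distr_eq_density[OF assms(4), symmetric] distributed_measurable[OF assms(4)]
    by (simp add: Lp_norm_def integral_distr)
  have X: "Lp_norm N r X = Lp_norm (std_gaussian :: (real ^ 'n) measure) r (\<lambda>x. norm x)" for r
  proof -
    have "(\<integral>x. \<bar>X x\<bar> powr r \<partial>N) = (\<integral>y. \<bar>y\<bar> powr r \<partial>distr N borel X)"
      using assms(6) by (subst integral_distr) auto
    also have "\<dots> = (\<integral>x. norm x powr r \<partial>(std_gaussian :: (real ^ 'n) measure))"
      unfolding assms(7) by (subst integral_distr) auto
    finally show ?thesis by (simp add: Lp_norm_def)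
  qed
  \<comment> \<open>Each ray moment is half of an absolute normal moment; the two halves, raised to
    \<open>1 / q\<close> and \<open>1 / p\<close>, leave the power of 2.\<close>
  have "proj_ratio p q std_gaussian (ray e) = 2 powr (1 / p - 1 / q) * (Lp_norm M q Z / Lp_norm M p Z)"
    by (simp add: proj_ratio_def Lp_norm_def[of std_gaussian] Z integral_proj_ray_powr[OF e] pq
        powr_divide powr_diff)
  moreover have "proj_ratio p q uniform_sphere (ray e) = proj_ratio p q std_gaussian (ray e) / (Lp_norm N q X / Lp_norm N p X)"
    using sphere[of "ray e"] ray by (simp add: c_def X)
  ultimately show ?thesis
    using A1 A2 ray unfolding e_def by simp
qed

end
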